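(* Let $E$ be a Hilbert $B$-module, $\mathcal{D}$ a regular self-adjoint operator on $E$, and $M$ a symmetric operator on $E$ such that $\mathrm{Dom}\,\mathcal{D}\cap\mathrm{Dom}\,M$ is dense. Let $\{\phi_k\}_{k\in\mathbb{N}}\subset\mathrm{End}_B(E)$ be an adequate approximate identity for $\mathcal{D}$ such that $M$ is locally bounded with respect to $\{\phi_k\}$ and $\sup_k\|[M,\phi_k]\|<\infty$. Then $\overline{\mathcal{D}+\bar M}$ is regular and self-adjoint. Furthermore, if $\phi_k\cdot\mathrm{Dom}\,\mathcal{D}\subset\mathrm{Dom}\,M$ for each $k$, then $\overline{\mathcal{D}+M}$ is regular and self-adjoint (and hence equal to $\overline{\mathcal{D}+\bar M}$).
   Context: A densely defined operator $S$ on $E$ is regular if $S^*$ is densely defined, $S$ is closed and $1+S^*S$ has dense range. A sequential approximate identity on $E$ is a sequence of self-adjoint $\phi_k\in\mathrm{End}_B(E)$ converging strongly to the identity. For a symmetric $\mathcal{D}$, an adequate approximate identity for $\mathcal{D}$ is a sequential approximate identity with $\phi_k\cdot\mathrm{Dom}\,\mathcal{D}^*\subset\mathrm{Dom}\,\bar{\mathcal{D}}$, $[\bar{\mathcal{D}},\phi_k]$ bounded on $\mathrm{Dom}\,\mathcal{D}$ for all $k$, and $\sup_k\|\overline{[\bar{\mathcal{D}},\phi_k]}\|<\infty$. A densely defined $M$ is locally bounded w.r.t. $\{\phi_k\}$ if $\phi_k\cdot\mathrm{Dom}\,M\subset\mathrm{Dom}\,M$ and $M\phi_k$ is bounded on $\mathrm{Dom}\,M$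 for all $k$. Sums have domain the intersection of domains. *)

theory Defs
  imports Complex_Main
begin

class cstar_algebra = banach + real_normed_algebra +
  fixes cstar :: "'a \<Rightarrow> 'a"
    and scaleC :: "complex \<Rightarrow> 'a \<Rightarrow> 'a"
  assumes scaleC_add_right: "scaleC c (x + y) = scaleC c x + scaleC c y"
    and scaleC_add_left: "scaleC (c + d) x = scaleC c x + scaleC d x"
    and scaleC_scaleC: "scaleC c (scaleC d x) = scaleC (c * d) x"
    and scaleC_one: "scaleC 1 x = x"
    and scaleC_of_real: "scaleC (complex_of_real r) x = scaleR r x"
    and norm_scaleC: "norm (scaleC c x) = cmod c * norm x"
    and mult_scaleC_left: "scaleC c x * y = scaleC c (x * y)"
    and mult_scaleC_right: "x * scaleC c y = scaleC c (x * y)"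
    and cstar_add: "cstar (x + y) = cstar x + cstar y"
    and cstar_scaleC: "cstar (scaleC c x) = scaleC (cnj c) (cstar x)"
    and cstar_mult: "cstar (x * y) = cstar y * cstar x"
    and cstar_cstar: "cstar (cstar x) = x"
    and cstar_identity: "norm (cstar x * x) = (norm x)\<^sup>2"

definition cstar_positive :: "'b::cstar_algebra \<Rightarrow> bool" where
  "cstar_positive a \<longleftrightarrow> (\<exists>c. a = cstar c * c)"

record ('e, 'b) hmod =
  hm_act :: "'e \<Rightarrow> 'b \<Rightarrow> 'e"
  hm_scal :: "complex \<Rightarrow> 'e \<Rightarrow> 'e"
  hm_inner :: "'e \<Rightarrow> 'e \<Rightarrow> 'b"     \<comment> \<open>B-valued inner product, linear in 2nd argument\<close>

definition hnorm :: "('e, 'b::cstar_algebra) hmod \<Rightarrow> 'e \<Rightarrow> real" where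
  "hnorm H x = sqrt (norm (hm_inner H x x))"

definition hconv :: "('e::ab_group_add, 'b::cstar_algebra) hmod \<Rightarrow> (nat \<Rightarrow> 'e) \<Rightarrow> 'e \<Rightarrow> bool" where
  "hconv H xs x \<longleftrightarrow> (\<lambda>n. hnorm H (xs n - x)) \<longlonglongrightarrow> 0"

definition hcauchy :: "('e::ab_group_add, 'b::cstar_algebra) hmod \<Rightarrow> (nat \<Rightarrow> 'e) \<Rightarrow> bool" where
  "hcauchy H xs \<longleftrightarrow> (\<forall>e>0. \<exists>N. \<forall>m\<ge>N. \<forall>n\<ge>N. hnorm H (xs m - xs n) < e)"

definition hdense :: "('e::ab_group_add, 'b::cstar_algebra) hmod \<Rightarrow> 'e set \<Rightarrow> bool" where
  "hdense H S \<longleftrightarrow> (\<forall>x. \<forall>e>0. \<exists>y\<in>S. hnorm H (x - y) < e)"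

definition hilbert_module :: "('e::ab_group_add, 'b::cstar_algebra) hmod \<Rightarrow> bool" where
  "hilbert_module H \<longleftrightarrow>
     (\<forall>c x y. hm_scal H c (x + y) = hm_scal H c x + hm_scal H c y) \<and>
     (\<forall>c d x. hm_scal H (c + d) x = hm_scal H c x + hm_scal H d x) \<and>
     (\<forall>c d x. hm_scal H c (hm_scal H d x) = hm_scal H (c * d) x) \<and>
     (\<forall>x. hm_scal H 1 x = x) \<and>
     (\<forall>x y a. hm_act H (x + y) a = hm_act H x a + hm_act H y a) \<and>
     (\<forall>x a b. hm_act H x (a + b) = hm_act H x a + hm_act H x b) \<and>
     (\<forall>x a b. hm_act H (hm_act H x a) b = hm_act H x (a * b)) \<and>
     (\<forall>c x a. hm_scal H c (hm_act H x a) = hm_act H (hm_scal H c x) a) \<and>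
     (\<forall>c x a. hm_scal H c (hm_act H x a) = hm_act H x (scaleC c a)) \<and>
     (\<forall>x y z. hm_inner H x (y + z) = hm_inner H x y + hm_inner H x z) \<and>
     (\<forall>c x y. hm_inner H x (hm_scal H c y) = scaleC c (hm_inner H x y)) \<and>
     (\<forall>x y a. hm_inner H x (hm_act H y a) = hm_inner H x y * a) \<and>
     (\<forall>x y. hm_inner H y x = cstar (hm_inner H x y)) \<and>
     (\<forall>x. cstar_positive (hm_inner H x x)) \<and>
     (\<forall>x. hm_inner H x x = 0 \<longrightarrow> x = 0) \<and>
     (\<forall>xs. hcauchy H xs \<longrightarrow> (\<exists>x. hconv H xs x))"

type_synonym 'e op = "'e set \<times> ('e \<Rightarrow> 'e)"

abbreviation dom_op :: "'e op \<Rightarrow> 'e set" where "dom_op S \<equiv> fst S"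
abbreviation app :: "'e op \<Rightarrow> 'e \<Rightarrow> 'e" where "app S \<equiv> snd S"

definition is_operator :: "('e::ab_group_add, 'b::cstar_algebra) hmod \<Rightarrow> 'e op \<Rightarrow> bool" where
  "is_operator H S \<longleftrightarrow>
     0 \<in> dom_op S \<and>
     (\<forall>x\<in>dom_op S. \<forall>y\<in>dom_op S. x + y \<in> dom_op S \<and> app S (x + y) = app S x + app S y) \<and>
     (\<forall>x\<in>dom_op S. \<forall>c. hm_scal H c x \<in> dom_op S \<and> app S (hm_scal H c x) = hm_scal H c (app S x)) \<and>
     (\<forall>x\<in>dom_op S. \<forall>a. hm_act H x a \<in> dom_op S \<and> app S (hm_act H x a) = hm_act H (app S x) a)"

definition densely_defined :: "('e::ab_group_add, 'b::cstar_algebra) hmod \<Rightarrow> 'e op \<Rightarrow> bool" where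
  "densely_defined H S \<longleftrightarrow> is_operator H S \<and> hdense H (dom_op S)"

definition adjoint :: "('e::ab_group_add, 'b::cstar_algebra) hmod \<Rightarrow> 'e op \<Rightarrow> 'e op" where
  "adjoint H S =
     ({y. \<exists>z. \<forall>x\<in>dom_op S. hm_inner H (app S x) y = hm_inner H x z},
      \<lambda>y. THE z. \<forall>x\<in>dom_op S. hm_inner H (app S x) y = hm_inner H x z)"

definition closed_op :: "('e::ab_group_add, 'b::cstar_algebra) hmod \<Rightarrow> 'e op \<Rightarrow> bool" where
  "closed_op H S \<longleftrightarrow>
     (\<forall>xs x y. (\<forall>n. xs n \<in> dom_op S) \<and> hconv H xs x \<and> hconv H (\<lambda>n. app S (xs n)) y
        \<longrightarrow> x \<in> dom_op S \<and> app S x = y)"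

definition op_closure :: "('e::ab_group_add, 'b::cstar_algebra) hmod \<Rightarrow> 'e op \<Rightarrow> 'e op" where
  "op_closure H S =
     ({x. \<exists>xs y. (\<forall>n. xs n \<in> dom_op S) \<and> hconv H xs x \<and> hconv H (\<lambda>n. app S (xs n)) y},
      \<lambda>x. THE y. \<exists>xs. (\<forall>n. xs n \<in> dom_op S) \<and> hconv H xs x \<and> hconv H (\<lambda>n. app S (xs n)) y)"

definition op_eq :: "'e op \<Rightarrow> 'e op \<Rightarrow> bool" where
  "op_eq S T \<longleftrightarrow> dom_op S = dom_op T \<and> (\<forall>x\<in>dom_op S. app S x = app T x)"

definition op_sum :: "'e::ab_group_add op \<Rightarrow> 'e op \<Rightarrow> 'e op" where
  "op_sum S T = (dom_op S \<inter> dom_op T, \<lambda>x. app S x + app T x)"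

definition symmetric_op :: "('e::ab_group_add, 'b::cstar_algebra) hmod \<Rightarrow> 'e op \<Rightarrow> bool" where
  "symmetric_op H S \<longleftrightarrow> densely_defined H S \<and>
     (\<forall>x\<in>dom_op S. \<forall>y\<in>dom_op S. hm_inner H (app S x) y = hm_inner H x (app S y))"

definition selfadjoint_op :: "('e::ab_group_add, 'b::cstar_algebra) hmod \<Rightarrow> 'e op \<Rightarrow> bool" where
  "selfadjoint_op H S \<longleftrightarrow> densely_defined H S \<and> op_eq S (adjoint H S)"

definition regular_op :: "('e::ab_group_add, 'b::cstar_algebra) hmod \<Rightarrow> 'e op \<Rightarrow> bool" where
  "regular_op H S \<longleftrightarrow> densely_defined H S \<and> densely_defined H (adjoint H S) \<and> closed_op H S \<and>
     hdense H {x + app (adjoint H S) (app S x) | x. x \<in> dom_op S \<and> app S x \<in> dom_op (adjoint H S)}"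

definition adjointable :: "('e::ab_group_add, 'b::cstar_algebra) hmod \<Rightarrow> ('e \<Rightarrow> 'e) \<Rightarrow> bool" where
  "adjointable H T \<longleftrightarrow> (\<exists>T'. \<forall>x y. hm_inner H (T x) y = hm_inner H x (T' y))"

definition selfadjoint_end :: "('e::ab_group_add, 'b::cstar_algebra) hmod \<Rightarrow> ('e \<Rightarrow> 'e) \<Rightarrow> bool" where
  "selfadjoint_end H T \<longleftrightarrow> adjointable H T \<and> (\<forall>x y. hm_inner H (T x) y = hm_inner H x (T y))"

definition seq_approx_id :: "('e::ab_group_add, 'b::cstar_algebra) hmod \<Rightarrow> (nat \<Rightarrow> 'e \<Rightarrow> 'e) \<Rightarrow> bool" where
  "seq_approx_id H \<phi> \<longleftrightarrow> (\<forall>k. selfadjoint_end H (\<phi> k)) \<and> (\<forall>x. hconv H (\<lambda>k. \<phi> k x) x)"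

definition bounded_on :: "('e::ab_group_add, 'b::cstar_algebra) hmod \<Rightarrow> 'e set \<Rightarrow> ('e \<Rightarrow> 'e) \<Rightarrow> bool" where
  "bounded_on H D f \<longleftrightarrow> (\<exists>C. \<forall>x\<in>D. hnorm H (f x) \<le> C * hnorm H x)"

definition commutator :: "'e::ab_group_add op \<Rightarrow> ('e \<Rightarrow> 'e) \<Rightarrow> 'e \<Rightarrow> 'e" where
  "commutator S f x = app S (f x) - f (app S x)"

text \<open>\<open>sup\<^sub>k \<parallel>closure [S, \<phi>\<^sub>k]\<parallel> < \<infinity>\<close>, where \<open>[S,\<phi>\<^sub>k]\<close> is considered on the dense
  domain D; the norm of the closure equals the supremum over D.\<close>
definition uniformly_bounded_comm ::
  "('e::ab_group_add, 'b::cstar_algebra) hmod \<Rightarrow> 'e set \<Rightarrow> 'e op \<Rightarrow> (nat \<Rightarrow> 'e \<Rightarrow> 'e) \<Rightarrow> bool" where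
  "uniformly_bounded_comm H D S \<phi> \<longleftrightarrow>
     (\<exists>C. \<forall>k. \<forall>x\<in>D. hnorm H (commutator S (\<phi> k) x) \<le> C * hnorm H x)"

definition adequate_approx_id :: "('e::ab_group_add, 'b::cstar_algebra) hmod \<Rightarrow> 'e op \<Rightarrow> (nat \<Rightarrow> 'e \<Rightarrow> 'e) \<Rightarrow> bool" where
  "adequate_approx_id H D \<phi> \<longleftrightarrow> seq_approx_id H \<phi> \<and>
     (\<forall>k. \<phi> k ` dom_op (adjoint H D) \<subseteq> dom_op (op_closure H D)) \<and>
     (\<forall>k. bounded_on H (dom_op D) (commutator (op_closure H D) (\<phi> k))) \<and>
     uniformly_bounded_comm H (dom_op D) (op_closure H D) \<phi>"

definition locally_bounded :: "('e::ab_group_add, 'b::cstar_algebra) hmod \<Rightarrow> 'e op \<Rightarrow> (nat \<Rightarrow> 'e \<Rightarrow> 'e) \<Rightarrow> bool" where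
  "locally_bounded H M \<phi> \<longleftrightarrow>
     (\<forall>k. \<phi> k ` dom_op M \<subseteq> dom_op M \<and> bounded_on H (dom_op M) (\<lambda>x. app M (\<phi> k x)))"

end

(* Let R = (D + i)^-1, P = closure of M, and G = (D + P + i mu) phi_k R, which is an adjointable
   bounded operator with range in the range of D + P + i mu. For small s > 0 the residual eta of
   s eta + G G* eta = s y satisfies <eta, y> >= <eta, eta>, and G* eta -> 0 as s -> 0, which
   says that phi_k eta approximately solves (D + P - i mu) phi_k eta = [D + M, phi_k] eta. Hence
   |mu| |phi_k eta|^2 <= C |phi_k eta| |eta| + small, where C bounds the commutators uniformly in
   k. For |mu| large and k such that phi_k y is close to y, this gives |eta| <= 3/4 |y|: every y
   is approximated by the range of D + P + i mu up to a fixed fraction, so the range is dense.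
   No localization at states of B is needed; the only input from C*-theory is the inequality
   |c*c| <= |c*c + d*d|, i.e. that the elements c*c are positive (Fukamiya). *)

theory Submission
  imports Defs "HOL-Analysis.Operator_Norm" "HOL-Computational_Algebra.Formal_Power_Series"
begin

subsection \<open>Basic identities in C*-algebras\<close>

text \<open>A closed submodule of a Hilbert module can be proper and still have zero orthogonal
  complement, so density of the range cannot be deduced from injectivity of the adjoint: approximate
  preimages must be constructed. The regularised equation does this, because \<open>s + G G*\<close>
  is invertible for every s > 0 whatever the range of G looks like. The factor R makes G everywhere
  defined with an everywhere defined adjoint, hence bounded. The bound on P phi_k may grow with k;
  it enters only the error term, which is made small by s after k is fixed, while the commutator
  bound survives the limit and therefore has to be uniform. Only a fixed fraction of y is reached at
  a time because k must be chosen before eta exists, hence from y alone; iteration over the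
  residuals then gives density. Fukamiya's theorem is needed at the very start: positivity of inner
  squares means being of the form c*c, and without comparing such elements not even the
  Cauchy-Schwarz inequality is available.\<close>

context cstar_algebra
begin

lemma scaleC_zero_left [simp]: "scaleC 0 x = 0"
  using scaleC_add_left[of 0 0 x] by simp

lemma scaleC_zero_right [simp]: "scaleC c 0 = 0"
  using scaleC_add_right[of c 0 0] by simp

lemma scaleC_minus_left: "scaleC (- c) x = - scaleC c x"
  using scaleC_add_left[of "- c" c x] by (simp add: eq_neg_iff_add_eq_0)

lemma scaleC_minus_right: "scaleC c (- x) = - scaleC c x"
  using scaleC_add_right[of c "- x" x] by (simp add: eq_neg_iff_add_eq_0)

lemma scaleC_diff_right: "scaleC c (x - y) = scaleC c x - scaleC c y"
  using scaleC_add_right[of c x "- y"] by (simp add: scaleC_minus_right)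

lemma cstar_zero [simp]: "cstar 0 = 0"
  using cstar_add[of 0 0] by simp

lemma cstar_minus: "cstar (- x) = - cstar x"
  using cstar_add[of "- x" x] by (simp add: eq_neg_iff_add_eq_0)

lemma cstar_diff: "cstar (x - y) = cstar x - cstar y"
  using cstar_add[of x "- y"] by (simp add: cstar_minus)

lemma cstar_scaleR: "cstar (scaleR r x) = scaleR r (cstar x)"
  using cstar_scaleC[of "complex_of_real r" x] by (simp add: scaleC_of_real)

end

lemma norm_cstar [simp]: "norm (cstar x) = norm (x::'a::cstar_algebra)"
proof -
  have le: "norm y \<le> norm (cstar y)" for y :: 'a
  proof (cases "y = 0")
    case False
    have "norm y * norm y \<le> norm (cstar y) * norm y"
      using norm_mult_ineq[of "cstar y" y] by (simp add: cstar_identity power2_eq_square)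
    with False show ?thesis by simp
  qed simp
  show ?thesis using le[of x] le[of "cstar x"] by (simp add: cstar_cstar)
qed

lemma bounded_linear_cstar: "bounded_linear (cstar :: 'a::cstar_algebra \<Rightarrow> 'a)"
  by (rule bounded_linear_intro[where K = 1]) (simp_all add: cstar_add cstar_scaleR)

lemma bounded_linear_scaleC: "bounded_linear (scaleC c :: 'a::cstar_algebra \<Rightarrow> 'a)"
proof (rule bounded_linear_intro[where K = "cmod c"])
  show "scaleC c (r *\<^sub>R x) = r *\<^sub>R scaleC c x" for r and x :: 'a
    by (metis mult.commute scaleC_of_real scaleC_scaleC)
qed (simp_all add: scaleC_add_right norm_scaleC)

subsection \<open>Unitization\<close>

class cstar_algebra_1 = cstar_algebra + real_normed_algebra_1

text \<open>Positivity is going to be expressed through \<open>of_real t - a\<close> and a power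
  series starting at 1, but B may lack a unit. A new one is adjoined in every case, which avoids a
  case distinction.\<close>

datatype 'b unitization = Unitization (alg_part: 'b) (scal_part: complex)

instantiation unitization :: (cstar_algebra) real_algebra_1
begin

definition "0 = Unitization 0 0"
definition "1 = Unitization 0 1"
definition "X + Y = Unitization (alg_part X + alg_part Y) (scal_part X + scal_part Y)"
definition "X - Y = Unitization (alg_part X - alg_part Y) (scal_part X - scal_part Y)"
definition "- X = Unitization (- alg_part X) (- scal_part X)"
definition "X * Y = Unitization
  (alg_part X * alg_part Y + scaleC (scal_part X) (alg_part Y) + scaleC (scal_part Y) (alg_part X))
  (scal_part X * scal_part Y)"
definition "r *\<^sub>R X = Unitization (r *\<^sub>R alg_part X) (r *\<^sub>R scal_part X)"

instance
proof
  fix X Y Z :: "'a unitization" and r s :: real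
  show "X * Y * Z = X * (Y * Z)"
    unfolding times_unitization_def
    by (simp add: algebra_simps scaleC_add_right scaleC_add_left scaleC_scaleC
      mult_scaleC_left mult_scaleC_right)
  show "(X + Y) * Z = X * Z + Y * Z" "X * (Y + Z) = X * Y + X * Z"
    unfolding times_unitization_def plus_unitization_def
    by (simp_all add: algebra_simps scaleC_add_right scaleC_add_left)
  have *: "scaleC (r *\<^sub>R c) x = r *\<^sub>R scaleC c x" for c and x :: 'a
    by (metis scaleC_of_real scaleC_scaleC scaleR_conv_of_real)
  have **: "scaleC c (r *\<^sub>R x) = r *\<^sub>R scaleC c x" for c and x :: 'a
    by (metis mult.commute scaleC_of_real scaleC_scaleC)
  show "r *\<^sub>R X * Y = r *\<^sub>R (X * Y)" "X * r *\<^sub>R Y = r *\<^sub>R (X * Y)"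
    unfolding times_unitization_def scaleR_unitization_def
    by (simp_all add: * ** scaleR_add_right)
qed (auto simp: zero_unitization_def one_unitization_def plus_unitization_def
      minus_unitization_def uminus_unitization_def times_unitization_def
      scaleR_unitization_def scaleC_one algebra_simps)

end

text \<open>B is an ideal of its unitization; the operator norm of this action on B is what inherits
  the C*-identity.\<close>

definition left_mult :: "'b::cstar_algebra unitization \<Rightarrow> 'b \<Rightarrow> 'b" where
  "left_mult X b = alg_part X * b + scaleC (scal_part X) b"

lemma bounded_linear_left_mult: "bounded_linear (left_mult X)"
  unfolding left_mult_def
  by (intro bounded_linear_add bounded_linear_mult_right bounded_linear_scaleC)

lemma left_mult_mult: "left_mult (X * Y) b = left_mult X (left_mult Y b)"
  by (simp add: left_mult_def times_unitization_def algebra_simps scaleC_add_right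
      scaleC_scaleC mult_scaleC_left mult_scaleC_right)

lemma left_mult_add: "left_mult (X + Y) b = left_mult X b + left_mult Y b"
  by (simp add: left_mult_def plus_unitization_def algebra_simps scaleC_add_left)

lemma left_mult_scaleR: "left_mult (r *\<^sub>R X) b = r *\<^sub>R left_mult X b"
  by (simp add: left_mult_def scaleR_unitization_def scaleR_add_right)
    (metis scaleC_of_real scaleC_scaleC scaleR_conv_of_real)

text \<open>The norm is attained at \<open>cstar a\<close>, by the C*-identity for
  \<open>a * cstar a\<close>.\<close>

lemma onorm_left_mult_alg: "onorm (left_mult (Unitization a 0)) = norm a"
proof (rule antisym)
  show "onorm (left_mult (Unitization a 0)) \<le> norm a"
    by (rule onorm_bound) (simp_all add: left_mult_def norm_mult_ineq)
  show "norm a \<le> onorm (left_mult (Unitization a 0))"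
  proof (cases "a = 0")
    case True
    then show ?thesis by (simp add: onorm_pos_le bounded_linear_left_mult)
  next
    case False
    have "norm (a * cstar a) = norm a * norm a"
      using cstar_identity[of "cstar a"] by (simp add: cstar_cstar power2_eq_square)
    then have "norm a * norm a \<le> onorm (left_mult (Unitization a 0)) * norm a"
      using onorm[OF bounded_linear_left_mult, of "Unitization a 0" "cstar a"]
      by (simp add: left_mult_def)
    with False show ?thesis by simp
  qed
qed

text \<open>The component \<^term>\<open>cmod (scal_part X)\<close> makes \<open>\<parallel>1\<parallel> = 1\<close> hold even over the zero algebra,
  and makes the norm definite even if the algebra already has a unit.\<close>

instantiation unitization :: (cstar_algebra) real_normed_algebra_1
begin

definition "norm X = max (onorm (left_mult X)) (cmod (scal_part X))"
definition "sgn (X :: 'a unitization) = X /\<^sub>R norm X"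
definition "dist (X :: 'a unitization) Y = norm (X - Y)"
definition [code del]:
  "(uniformity :: ('a unitization \<times> 'a unitization) filter) = (INF e\<in>{0<..}. principal {(x, y). dist x y < e})"
definition [code del]:
  "open (U :: 'a unitization set) \<longleftrightarrow> (\<forall>x\<in>U. eventually (\<lambda>(x', y). x' = x \<longrightarrow> y \<in> U) uniformity)"

instance
proof
  fix X Y :: "'a unitization" and r :: real
  show "norm (X + Y) \<le> norm X + norm Y"
  proof -
    have "onorm (left_mult (X + Y)) \<le> onorm (left_mult X) + onorm (left_mult Y)"
      using onorm_triangle[OF bounded_linear_left_mult bounded_linear_left_mult, of X Y]
      by (simp add: left_mult_add[abs_def])
    moreover have "cmod (scal_part (X + Y)) \<le> cmod (scal_part X) + cmod (scal_part Y)"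
      by (simp add: plus_unitization_def norm_triangle_ineq)
    ultimately show ?thesis unfolding norm_unitization_def by linarith
  qed
  show "norm (X * Y) \<le> norm X * norm Y"
  proof -
    have "onorm (left_mult (X * Y)) \<le> onorm (left_mult X) * onorm (left_mult Y)"
      using onorm_compose[OF bounded_linear_left_mult bounded_linear_left_mult, of X Y]
      by (simp add: left_mult_mult[abs_def] o_def)
    also have "\<dots> \<le> norm X * norm Y" unfolding norm_unitization_def
      by (intro mult_mono) (auto simp: onorm_pos_le bounded_linear_left_mult le_max_iff_disj)
    moreover have "cmod (scal_part (X * Y)) \<le> norm X * norm Y"
      unfolding times_unitization_def norm_unitization_def
      by (auto simp: norm_mult le_max_iff_disj intro!: mult_mono)
    ultimately show ?thesis unfolding norm_unitization_def[of "X * Y"] by linarith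
  qed
  show "norm (r *\<^sub>R X) = \<bar>r\<bar> * norm X"
  proof -
    have "onorm (left_mult (r *\<^sub>R X)) = \<bar>r\<bar> * onorm (left_mult X)"
      using onorm_scaleR[OF bounded_linear_left_mult, of r X]
      by (simp add: left_mult_scaleR[abs_def])
    then show ?thesis
      by (simp add: norm_unitization_def scaleR_unitization_def max_mult_distrib_left)
  qed
  show "norm X = 0 \<longleftrightarrow> X = 0"
  proof
    assume *: "norm X = 0"
    then have "max (onorm (left_mult X)) (cmod (scal_part X)) \<le> 0"
      by (simp add: norm_unitization_def)
    then have "cmod (scal_part X) \<le> 0" "onorm (left_mult X) \<le> 0"
      unfolding max.bounded_iff by blast+
    moreover obtain a c where X: "X = Unitization a c" by (cases X)
    ultimately show "X = 0"
      by (metis norm_le_zero_iff onorm_left_mult_alg unitization.sel(2) zero_unitization_def)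
  next
    assume "X = 0"
    then show "norm X = 0"
      by (simp add: norm_unitization_def zero_unitization_def onorm_left_mult_alg)
  qed
  show "norm (1::'a unitization) = 1"
    by (simp add: norm_unitization_def one_unitization_def left_mult_def[abs_def] scaleC_one
        onorm_id_le max_absorb2)
qed (rule sgn_unitization_def dist_unitization_def uniformity_unitization_def open_unitization_def)+

end

lemma norm_Unitization_alg: "norm (Unitization a 0) = norm (a::'a::cstar_algebra)"
  by (simp add: norm_unitization_def onorm_left_mult_alg)

lemma norm_scal_part_le: "cmod (scal_part X) \<le> norm X"
  by (simp add: norm_unitization_def)

lemma norm_Unitization_scal: "norm (Unitization (0::'a::cstar_algebra) c) \<le> cmod c"
proof -
  have "onorm (left_mult (Unitization (0::'a) c)) \<le> cmod c"
    by (rule onorm_bound) (simp_all add: left_mult_def norm_scaleC)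
  then show ?thesis by (simp add: norm_unitization_def)
qed

lemma norm_alg_part_le: "norm (alg_part X) \<le> 2 * norm X"
proof -
  have "Unitization (alg_part X) 0 = X - Unitization 0 (scal_part X)"
    by (simp add: minus_unitization_def)
  then have "norm (alg_part X) \<le> norm X + norm (Unitization (0::'a) (scal_part X))"
    by (metis norm_Unitization_alg norm_triangle_ineq4)
  then show ?thesis
    using norm_Unitization_scal[of "scal_part X", where 'a = 'a] norm_scal_part_le[of X] by linarith
qed

text \<open>Both coordinates are bounded linear, and the norm is at most the sum of the coordinate
  norms; so convergence is coordinatewise.\<close>

instance unitization :: (cstar_algebra) banach
proof
  fix X :: "nat \<Rightarrow> 'a unitization"
  assume X: "Cauchy X"
  have "bounded_linear (scal_part :: 'a unitization \<Rightarrow> complex)"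
    by (rule bounded_linear_intro[where K = 1])
      (simp_all add: plus_unitization_def scaleR_unitization_def norm_scal_part_le)
  then obtain c where c: "(\<lambda>n. scal_part (X n)) \<longlonglongrightarrow> c"
    using bounded_linear.Cauchy[OF _ X] Cauchy_convergent convergent_def by blast
  have "bounded_linear (alg_part :: 'a unitization \<Rightarrow> 'a)"
    by (rule bounded_linear_intro[where K = 2])
      (use norm_alg_part_le in \<open>simp_all add: plus_unitization_def scaleR_unitization_def mult.commute\<close>)
  then obtain a where a: "(\<lambda>n. alg_part (X n)) \<longlonglongrightarrow> a"
    using bounded_linear.Cauchy[OF _ X] Cauchy_convergent convergent_def by blast
  have "(\<lambda>n. norm (alg_part (X n) - a) + cmod (scal_part (X n) - c)) \<longlonglongrightarrow> 0"
    using tendsto_add[OF tendsto_norm_zero[OF LIM_zero[OF a]] tendsto_norm_zero[OF LIM_zero[OF c]]]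
    by simp
  moreover have "norm (X n - Unitization a c) \<le> norm (alg_part (X n) - a) + cmod (scal_part (X n) - c)" for n
  proof -
    have "X n - Unitization a c =
        Unitization (alg_part (X n) - a) 0 + Unitization 0 (scal_part (X n) - c)"
      by (simp add: minus_unitization_def plus_unitization_def)
    then show ?thesis
      by (metis (no_types, opaque_lifting) add_left_mono norm_Unitization_alg norm_Unitization_scal
          norm_triangle_le)
  qed
  ultimately have "(\<lambda>n. X n - Unitization a c) \<longlonglongrightarrow> 0"
    by (elim tendsto_0_le[where K = 1]) (auto intro: eventuallyI order_trans)
  then show "convergent X" using LIM_zero_cancel convergent_def by blast
qed

instantiation unitization :: (cstar_algebra) cstar_algebra_1
begin

definition "cstar X = Unitization (cstar (alg_part X)) (cnj (scal_part X))"
definition "scaleC c X = Unitization (scaleC c (alg_part X)) (c * scal_part X)"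

instance
proof
  fix X Y :: "'a unitization" and c d :: complex and r :: real
  show "cstar (X * Y) = cstar Y * cstar X"
    by (simp add: cstar_unitization_def times_unitization_def cstar_add cstar_mult cstar_scaleC
        algebra_simps)
  show "scaleC (complex_of_real r) X = r *\<^sub>R X"
    by (simp add: scaleC_unitization_def scaleR_unitization_def scaleC_of_real scaleR_conv_of_real)
  show "norm (scaleC c X) = cmod c * norm X"
  proof -
    have le: "norm (scaleC c X) \<le> cmod c * norm X" for c and X :: "'a unitization"
    proof -
      have "left_mult (scaleC c X) b = scaleC c (left_mult X b)" for b
        by (simp add: left_mult_def scaleC_unitization_def scaleC_add_right scaleC_scaleC
            mult_scaleC_left)
      then have "onorm (left_mult (scaleC c X)) \<le> cmod c * onorm (left_mult X)"
        by (intro onorm_bound) (auto simp: norm_scaleC onorm_pos_le bounded_linear_left_mult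
            mult.assoc intro!: mult_left_mono onorm)
      then show ?thesis
        unfolding norm_unitization_def
        by (simp add: scaleC_unitization_def norm_mult max_mult_distrib_left max.coboundedI1)
    qed
    show ?thesis
    proof (cases "c = 0")
      case True
      then show ?thesis using le[of 0 X] by simp
    next
      case False
      have "scaleC (inverse c) (scaleC c X) = X"
        using False by (simp add: scaleC_unitization_def scaleC_scaleC scaleC_one mult.assoc[symmetric])
      then have "norm X \<le> cmod (inverse c) * norm (scaleC c X)"
        using le[of "inverse c" "scaleC c X"] by simp
      then have "cmod c * norm X \<le> norm (scaleC c X)"
        using False by (simp add: norm_divide inverse_eq_divide pos_le_divide_eq mult.commute)
      with le[of c X] show ?thesis by simp
    qed
  qed
  show "norm (cstar X * X) = (norm X)\<^sup>2"
  proof (rule antisym)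
    \<comment> \<open>The C*-identity of B turns the square of \<open>norm (left_mult Y b)\<close>
      into the norm of \<open>cstar b * left_mult (cstar Y * Y) b\<close>.\<close>
    have onorm_le: "(onorm (left_mult Y))\<^sup>2 \<le> onorm (left_mult (cstar Y * Y))" for Y :: "'a unitization"
    proof -
      let ?m = "onorm (left_mult (cstar Y * Y))"
      have m: "0 \<le> ?m" by (simp add: onorm_pos_le bounded_linear_left_mult)
      have "norm (left_mult Y b) \<le> sqrt ?m * norm b" for b
      proof -
        have "cstar (left_mult Y b) * left_mult Y b = cstar b * left_mult (cstar Y * Y) b"
          by (simp add: left_mult_mult)
            (simp add: left_mult_def cstar_unitization_def cstar_add cstar_mult cstar_scaleC
              algebra_simps mult_scaleC_left mult_scaleC_right scaleC_add_right scaleC_scaleC)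
        then have "(norm (left_mult Y b))\<^sup>2 = norm (cstar b * left_mult (cstar Y * Y) b)"
          by (simp flip: cstar_identity)
        also have "\<dots> \<le> norm b * (?m * norm b)"
          using norm_mult_ineq[of "cstar b" "left_mult (cstar Y * Y) b"]
            mult_left_mono[OF onorm[OF bounded_linear_left_mult, of "cstar Y * Y" b], of "norm b"]
          by simp
        also have "\<dots> = (sqrt ?m * norm b)\<^sup>2"
          using m by (simp add: power_mult_distrib power2_eq_square)
        finally show ?thesis by (rule power2_le_imp_le) (use m in simp)
      qed
      then have "onorm (left_mult Y) \<le> sqrt ?m"
        by (intro onorm_bound) (use m in auto)
      then show ?thesis
        by (metis m onorm_pos_le bounded_linear_left_mult power_mono real_sqrt_pow2)
    qed
    have le: "(norm Y)\<^sup>2 \<le> norm (cstar Y * Y)" for Y :: "'a unitization"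
    proof -
      have "(cmod (scal_part Y))\<^sup>2 = cmod (scal_part (cstar Y * Y))"
        by (simp add: cstar_unitization_def times_unitization_def norm_mult power2_eq_square)
      then show ?thesis
        unfolding norm_unitization_def
        using onorm_le[of Y] by (auto simp: max_def)
    qed
    show "(norm X)\<^sup>2 \<le> norm (cstar X * X)" by (rule le)
    have norm_le: "norm Y \<le> norm (cstar Y)" for Y :: "'a unitization"
    proof (cases "Y = 0")
      case False
      have "norm Y * norm Y \<le> norm (cstar Y) * norm Y"
        using order_trans[OF le norm_mult_ineq, of Y] by (simp add: power2_eq_square)
      with False show ?thesis by simp
    qed simp
    have "cstar (cstar X) = X" by (simp add: cstar_unitization_def cstar_cstar)
    with norm_le[of "cstar X"] have "norm (cstar X) \<le> norm X" by simp
    then show "norm (cstar X * X) \<le> (norm X)\<^sup>2"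
      using norm_mult_ineq[of "cstar X" X] mult_right_mono[of "norm (cstar X)" "norm X" "norm X"]
      by (simp add: power2_eq_square)
  qed
qed (auto simp: cstar_unitization_def scaleC_unitization_def plus_unitization_def
      times_unitization_def scaleC_add_right scaleC_add_left scaleC_scaleC scaleC_one
      mult_scaleC_left mult_scaleC_right cstar_add cstar_scaleC cstar_cstar algebra_simps)

end

subsection \<open>Positivity in unital C*-algebras\<close>

text \<open>Taylor coefficients of \<open>sqrt (1 - x)\<close> at 0. All but the first are
  nonpositive, which gives absolute convergence up to the boundary
  \<open>norm x = 1\<close>.\<close>

definition sqrt_coeff :: "nat \<Rightarrow> real" where
  "sqrt_coeff n = ((1 / 2) gchoose n) * (- 1) ^ n"

lemma sqrt_coeff_0 [simp]: "sqrt_coeff 0 = 1"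
  by (simp add: sqrt_coeff_def)

lemma sqrt_coeff_Suc: "real (Suc n) * sqrt_coeff (Suc n) = (real n - 1 / 2) * sqrt_coeff n"
proof -
  have "real (Suc n) * ((1 / 2 :: real) gchoose Suc n) = (1 / 2 - real n) * ((1 / 2) gchoose n)"
    using gbinomial_mult_1[of "1 / 2 :: real" n] by (simp add: algebra_simps)
  then have "real (Suc n) * ((1 / 2 :: real) gchoose Suc n) * (- 1) ^ Suc n
      = (1 / 2 - real n) * ((1 / 2) gchoose n) * (- 1) ^ Suc n" by (rule arg_cong)
  then show ?thesis
    unfolding sqrt_coeff_def by (simp add: algebra_simps)
qed

lemma sqrt_coeff_Suc_nonpos: "sqrt_coeff (Suc n) \<le> 0"
proof (induction n)
  case 0
  then show ?case using sqrt_coeff_Suc[of 0] by simp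
next
  case (Suc n)
  have "real (Suc (Suc n)) * sqrt_coeff (Suc (Suc n)) \<le> 0"
    unfolding sqrt_coeff_Suc[of "Suc n"] using Suc by (intro mult_nonneg_nonpos) auto
  then show ?case by (simp add: mult_le_0_iff)
qed

text \<open>This closed form exhibits the sign of the partial sums, since
  \<open>sqrt_coeff (Suc N)\<close> is nonpositive.\<close>

lemma sum_sqrt_coeff: "(\<Sum>n\<le>N. sqrt_coeff n) = - (2 * real (Suc N) * sqrt_coeff (Suc N))"
proof (induction N)
  case 0
  then show ?case using sqrt_coeff_Suc[of 0] by simp
next
  case (Suc N)
  then show ?case using sqrt_coeff_Suc[of "Suc N"] by (simp add: algebra_simps)
qed

text \<open>The partial sums are nonnegative and start with 1, and the remaining terms share one
  sign. The same bound 1 later shows that the root s satisfies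
  \<open>norm (1 - s) \<le> 1\<close>.\<close>

lemma sum_abs_sqrt_coeff: "(\<Sum>n<N. \<bar>sqrt_coeff (Suc n)\<bar>) \<le> 1"
proof -
  have "0 \<le> (\<Sum>n\<le>N. sqrt_coeff n)"
    unfolding sum_sqrt_coeff using sqrt_coeff_Suc_nonpos[of N] by (simp add: mult_le_0_iff)
  moreover have "(\<Sum>n\<le>N. sqrt_coeff n) = 1 + (\<Sum>n<N. sqrt_coeff (Suc n))"
    using sum.lessThan_Suc_shift[of sqrt_coeff N] by (simp add: lessThan_Suc_atMost)
  moreover have "(\<Sum>n<N. \<bar>sqrt_coeff (Suc n)\<bar>) = - (\<Sum>n<N. sqrt_coeff (Suc n))"
    by (simp add: sum_negf[symmetric] sqrt_coeff_Suc_nonpos)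
  ultimately show ?thesis by simp
qed

lemma summable_abs_sqrt_coeff: "summable (\<lambda>n. \<bar>sqrt_coeff n\<bar>)"
proof -
  have "summable (\<lambda>n. \<bar>sqrt_coeff (Suc n)\<bar>)"
    by (rule bounded_imp_summable[where B = 1])
      (use sum_abs_sqrt_coeff[of "Suc _"] in \<open>simp_all add: lessThan_Suc_atMost\<close>)
  then show ?thesis using summable_Suc_iff[of "\<lambda>n. \<bar>sqrt_coeff n\<bar>"] by blast
qed

text \<open>Vandermonde's identity with both exponents 1/2: the square of the series is the
  expansion of \<open>1 - x\<close>.\<close>

lemma sqrt_coeff_convolution:
  "(\<Sum>i\<le>k. sqrt_coeff i * sqrt_coeff (k - i)) = (if k = 0 then 1 else if k = 1 then - 1 else 0)"
proof -
  have "(\<Sum>i\<le>k. sqrt_coeff i * sqrt_coeff (k - i))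
      = (\<Sum>i\<le>k. ((1 / 2) gchoose i) * ((1 / 2) gchoose (k - i))) * (- 1) ^ k"
    unfolding sum_distrib_right sqrt_coeff_def
    by (intro sum.cong) (auto simp: power_add[symmetric] algebra_simps)
  also have "\<dots> = ((1 :: real) gchoose k) * (- 1) ^ k"
    using gbinomial_Vandermonde[of "1 / 2 :: real" "1 / 2" k] by (simp add: atLeast0AtMost)
  also have "(1 :: real) gchoose k = of_nat (1 choose k)"
    using binomial_gbinomial[of 1 k, where 'a = real] by simp
  finally show ?thesis by (auto simp: binomial_eq_0)
qed

section \<open>Summing the series in a unital C*-algebra\<close>

lemma cstar_power: "cstar (x ^ n) = cstar (x :: 'a::cstar_algebra_1) ^ n"
proof (induction n)
  case 0
  show ?case by simp (metis cstar_cstar cstar_mult mult.right_neutral)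
next
  case (Suc n)
  then show ?case by (simp add: cstar_mult power_commutes)
qed

lemma cstar_one [simp]: "cstar 1 = (1 :: 'a::cstar_algebra_1)"
  using cstar_power[of 1 0] by simp

lemma cstar_of_real [simp]: "cstar (of_real r) = (of_real r :: 'a::cstar_algebra_1)"
  by (simp add: of_real_def cstar_scaleR)

proposition sqrt_one_minus:
  fixes x :: "'a::cstar_algebra_1"
  assumes x: "cstar x = x" "norm x \<le> 1"
  obtains s where "cstar s = s" "s * s = 1 - x" "norm (1 - s) \<le> 1"
    "\<And>z. z * x = x * z \<Longrightarrow> z * s = s * z"
proof
  define f where "f n = sqrt_coeff n *\<^sub>R x ^ n" for n
  have norm_f: "norm (f n) \<le> \<bar>sqrt_coeff n\<bar>" for n
  proof -
    have "norm (x ^ n) \<le> 1" using x(2) norm_power_ineq[of x n] power_le_one[of "norm x" n] by simp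
    then show ?thesis unfolding f_def by (simp add: mult_left_le)
  qed
  have sum_norm: "summable (\<lambda>n. norm (f n))"
    by (rule summable_comparison_test'[OF summable_abs_sqrt_coeff]) (simp add: norm_f)
  then have sum_f: "summable f" by (rule summable_norm_cancel)
  let ?s = "suminf f"
  show "cstar ?s = ?s"
    unfolding bounded_linear.suminf[OF bounded_linear_cstar sum_f]
    by (simp add: f_def[abs_def] cstar_scaleR cstar_power x)
  show "z * ?s = ?s * z" if "z * x = x * z" for z
    unfolding suminf_mult[OF sum_f, symmetric] suminf_mult2[OF sum_f]
    by (simp add: f_def power_commuting_commutes[OF that[symmetric]])
  have conv: "(\<Sum>i\<le>k. f i * f (k - i)) = (if k = 0 then 1 else if k = 1 then - x else 0)" for k
  proof -
    have "(\<Sum>i\<le>k. f i * f (k - i)) = (\<Sum>i\<le>k. sqrt_coeff i * sqrt_coeff (k - i)) *\<^sub>R x ^ k"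
      unfolding f_def scaleR_sum_left by (intro sum.cong) (auto simp: power_add[symmetric])
    then show ?thesis unfolding sqrt_coeff_convolution by simp
  qed
  have "(\<lambda>k. \<Sum>i\<le>k. f i * f (k - i)) sums (?s * ?s)"
    by (rule Cauchy_product_sums[OF sum_norm sum_norm])
  moreover have "(\<lambda>k. \<Sum>i\<le>k. f i * f (k - i)) sums (\<Sum>k<2. \<Sum>i\<le>k. f i * f (k - i))"
    by (rule sums_finite) (auto simp: conv)
  ultimately have "?s * ?s = (\<Sum>k<2. \<Sum>i\<le>k. f i * f (k - i))" by (rule sums_unique2)
  then show "?s * ?s = 1 - x" by (simp add: conv numeral_2_eq_2)
  have sum_norm': "summable (\<lambda>n. norm (f (Suc n)))"
    using sum_norm summable_Suc_iff[of "\<lambda>n. norm (f n)"] by blast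
  have sum_coeff': "summable (\<lambda>n. \<bar>sqrt_coeff (Suc n)\<bar>)"
    using summable_abs_sqrt_coeff summable_Suc_iff[of "\<lambda>n. \<bar>sqrt_coeff n\<bar>"] by blast
  have "norm (\<Sum>n. f (Suc n)) \<le> (\<Sum>n. norm (f (Suc n)))"
    by (rule summable_norm[OF sum_norm'])
  also have "\<dots> \<le> (\<Sum>n. \<bar>sqrt_coeff (Suc n)\<bar>)"
    by (rule suminf_le[OF norm_f sum_norm' sum_coeff'])
  also have "\<dots> \<le> 1"
    by (rule suminf_le_const[OF sum_coeff' sum_abs_sqrt_coeff])
  finally show "norm (1 - ?s) \<le> 1"
    using suminf_split_head[OF sum_f] by (simp add: f_def norm_minus_commute)
qed

text \<open>For self-adjoint a this says that the spectrum lies in [0, infinity): the disc of radius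
  t about t meets the real line in \<open>[0, 2 t]\<close>. In this form closure under sums is just
  the triangle inequality.\<close>

definition cpos :: "'a::cstar_algebra_1 \<Rightarrow> bool" where
  "cpos a \<longleftrightarrow> cstar a = a \<and> (\<exists>t. norm (of_real t - a) \<le> t)"

lemma cpos_add: "cpos a \<Longrightarrow> cpos b \<Longrightarrow> cpos (a + b)"
proof -
  assume "cpos a" "cpos b"
  then obtain s t where *: "norm (of_real s - a) \<le> s" "norm (of_real t - b) \<le> t"
    and "cstar a = a" "cstar b = b" unfolding cpos_def by blast
  have "of_real (s + t) - (a + b) = (of_real s - a) + (of_real t - b)" by simp
  then have "norm (of_real (s + t) - (a + b)) \<le> s + t"
    using * by (metis norm_triangle_mono)
  then show ?thesis unfolding cpos_def using \<open>cstar a = a\<close> \<open>cstar b = b\<close> by (metis cstar_add)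
qed

lemma cpos_scaleR: "cpos a \<Longrightarrow> 0 \<le> r \<Longrightarrow> cpos (r *\<^sub>R a)"
proof -
  assume "cpos a" and r: "0 \<le> r"
  then obtain t where t: "norm (of_real t - a) \<le> t" and "cstar a = a" unfolding cpos_def by blast
  have "of_real (r * t) - r *\<^sub>R a = r *\<^sub>R (of_real t - a)"
    by (simp add: of_real_def scaleR_diff_right)
  then have "norm (of_real (r * t) - r *\<^sub>R a) \<le> r * t" using r t by (simp add: mult_left_mono)
  then show ?thesis unfolding cpos_def using \<open>cstar a = a\<close> by (metis cstar_scaleR)
qed

lemma cpos_norm_minus: "cstar a = a \<Longrightarrow> cpos (of_real (norm a) - a)"
  unfolding cpos_def by (auto simp: cstar_diff intro!: exI[of _ "norm a"])

text \<open>A witness t > 0 writes a as \<open>t (1 - x)\<close> with \<open>norm x \<le> 1\<close>,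
  so the series applies. The commutation clause lets the root be moved past everything that commutes
  with a.\<close>

lemma cpos_sqrt:
  assumes "cpos a"
  obtains s where "cpos s" "s * s = a" "\<And>z. z * a = a * z \<Longrightarrow> z * s = s * z"
proof -
  from assms obtain t where t: "norm (of_real t - a) \<le> t" and a: "cstar a = a"
    unfolding cpos_def by blast
  then have "t \<ge> 0" using norm_ge_zero order_trans by blast
  show thesis
  proof (cases "t = 0")
    case True
    with t have "a = 0" by simp
    then show thesis by (intro that[of 0]) (auto simp: cpos_def intro!: exI[of _ 0])
  next
    case False
    with \<open>t \<ge> 0\<close> have "t > 0" by simp
    define x where "x = inverse t *\<^sub>R (of_real t - a)"
    have x: "cstar x = x" "norm x \<le> 1"
      unfolding x_def using a t \<open>t > 0\<close>
      by (simp_all add: cstar_scaleR cstar_diff divide_le_eq inverse_eq_divide)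
    have tx: "t *\<^sub>R (1 - x) = a"
      unfolding x_def using \<open>t > 0\<close> by (simp add: of_real_def scaleR_diff_right)
    from sqrt_one_minus[OF x] obtain s where s: "cstar s = s" "s * s = 1 - x" "norm (1 - s) \<le> 1"
      "\<And>z. z * x = x * z \<Longrightarrow> z * s = s * z" by blast
    show thesis
    proof (rule that[of "sqrt t *\<^sub>R s"])
      have "cpos s" unfolding cpos_def using s(1,3) by (auto intro!: exI[of _ 1])
      then show "cpos (sqrt t *\<^sub>R s)" by (rule cpos_scaleR) (use \<open>t > 0\<close> in simp)
      show "sqrt t *\<^sub>R s * sqrt t *\<^sub>R s = a" using s(2) tx \<open>t > 0\<close> by simp
      fix z assume "z * a = a * z"
      then have "z * x = x * z"
        unfolding x_def by (simp add: algebra_simps of_real_def)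
      then show "z * sqrt t *\<^sub>R s = sqrt t *\<^sub>R s * z" using s(4) by simp
    qed
  qed
qed

text \<open>With \<open>u = h + \<i> sqrt (1 - h\<^sup>2)\<close> unitary, \<open>1 - h\<^sup>2 = (2 - u\<^sup>2 - u\<^sup>*\<^sup>2) / 4\<close>.\<close>

lemma norm_one_minus_square:
  fixes h :: "'a::cstar_algebra_1"
  assumes h: "cstar h = h" "norm h \<le> 1"
  shows "norm (1 - h * h) \<le> 1"
proof -
  have "norm (h * h) \<le> 1"
    using norm_mult_ineq[of h h] mult_mono[OF h(2) h(2)] by simp
  moreover have "cstar (h * h) = h * h" by (simp add: cstar_mult h)
  ultimately obtain k where k: "cstar k = k" "k * k = 1 - h * h"
    "\<And>z. z * (h * h) = (h * h) * z \<Longrightarrow> z * k = k * z"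
    using sqrt_one_minus[of "h * h"] by metis
  have hk: "h * k = k * h" by (rule k(3)) (simp add: mult.assoc)
  define u where "u = h + scaleC \<i> k"
  have cu: "cstar u = h - scaleC \<i> k"
    unfolding u_def by (simp add: cstar_add cstar_scaleC h k scaleC_minus_left)
  have uu: "cstar u * u = 1"
    unfolding cu unfolding u_def
    by (simp add: algebra_simps hk mult_scaleC_left mult_scaleC_right scaleC_scaleC scaleC_minus_left
        scaleC_add_right scaleC_diff_right scaleC_one k(2))
  have norm_u: "norm u = 1"
    by (metis abs_norm_cancel abs_square_eq_1 cstar_identity norm_one uu)
  have "u * u + cstar u * cstar u = 2 * (h * h) - 2 * (k * k)"
    unfolding cu unfolding u_def
    by (simp add: algebra_simps hk mult_scaleC_left mult_scaleC_right scaleC_scaleC scaleC_minus_left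
        scaleC_add_right scaleC_diff_right scaleC_one k(2) flip: mult_2)
  moreover have "4 * (h * h) = 2 * (h * h) + 2 * (h * h)" by (simp flip: distrib_right)
  ultimately have "u * u + cstar u * cstar u = 4 * (h * h) - 2"
    by (simp add: algebra_simps k(2))
  then have "4 *\<^sub>R (1 - h * h) = 2 - u * u - cstar u * cstar u"
    by (simp add: right_diff_distrib diff_diff_eq scaleR_conv_of_real)
  then have "1 - h * h = (1 / 4 :: real) *\<^sub>R (2 - u * u - cstar u * cstar u)"
    by (simp flip: \<open>4 *\<^sub>R (1 - h * h) = _\<close>)
  moreover have "norm (2 - u * u - cstar u * cstar u) \<le> 4"
  proof -
    have "norm (u * u) \<le> 1" "norm (cstar u * cstar u) \<le> 1"
      using norm_mult_ineq[of u u] norm_mult_ineq[of "cstar u" "cstar u"] norm_u by simp_all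
    moreover have "norm (2 :: 'a) = 2" by simp
    ultimately show ?thesis
      using norm_triangle_ineq4[of "2 - u * u" "cstar u * cstar u"] norm_triangle_ineq4[of 2 "u * u"]
      by linarith
  qed
  ultimately show ?thesis by simp
qed

lemma norm_square_selfadjoint: "cstar h = h \<Longrightarrow> norm (h * h) = (norm h)\<^sup>2"
  using cstar_identity[of h] by simp

lemma norm_minus_square_le:
  fixes h :: "'a::cstar_algebra_1"
  assumes h: "cstar h = h"
  shows "norm (of_real (norm (h * h)) - h * h) \<le> norm (h * h)"
proof (cases "h = 0")
  case False
  let ?n = "norm h"
  have n: "?n > 0" using False by simp
  define g where "g = inverse ?n *\<^sub>R h"
  have "norm (1 - g * g) \<le> 1"
    by (rule norm_one_minus_square) (use n in \<open>simp_all add: g_def cstar_scaleR h\<close>)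
  moreover have "of_real (norm (h * h)) - h * h = ?n\<^sup>2 *\<^sub>R (1 - g * g)"
    unfolding g_def norm_square_selfadjoint[OF h] using n
    by (simp add: scaleR_diff_right of_real_def power2_eq_square field_simps)
  ultimately show ?thesis
    using norm_square_selfadjoint[OF h] by (simp add: mult_left_le)
qed simp

lemma cpos_square: "cstar h = h \<Longrightarrow> cpos (h * h)"
  unfolding cpos_def using norm_minus_square_le by (auto simp: cstar_mult)

text \<open>A positive element is a square of a self-adjoint one, so the unknown witness t can be
  replaced by the norm.\<close>

lemma cpos_norm_minus_le:
  assumes "cpos p" shows "norm (of_real (norm p) - p) \<le> norm p"
proof -
  obtain s where s: "cpos s" "s * s = p" using cpos_sqrt[OF assms] by blast
  then show ?thesis using norm_minus_square_le[of s] by (simp add: cpos_def)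
qed

text \<open>The roots x of p and y of \<open>m - p\<close> commute, so \<open>u = x + i y\<close>
  satisfies \<open>cstar u * u = m\<close>. As x is the real part of u, its norm is at most that of
  u.\<close>

lemma cpos_norm_le:
  assumes p: "cpos p" and m: "cpos (of_real m - p)" "0 \<le> m"
  shows "norm p \<le> m"
proof -
  obtain x where x: "cpos x" "x * x = p" "\<And>z. z * p = p * z \<Longrightarrow> z * x = x * z"
    using cpos_sqrt[OF p] by blast
  obtain y where y: "cpos y" "y * y = of_real m - p"
    "\<And>z. z * (of_real m - p) = (of_real m - p) * z \<Longrightarrow> z * y = y * z"
    using cpos_sqrt[OF m(1)] by blast
  have xs: "cstar x = x" and ys: "cstar y = y" using x(1) y(1) by (auto simp: cpos_def)
  have xy: "x * y = y * x"
    by (rule y(3)) (simp add: x(2)[symmetric] algebra_simps of_real_def)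
  define u where "u = x + scaleC \<i> y"
  have cu: "cstar u = x - scaleC \<i> y"
    unfolding u_def by (simp add: cstar_add cstar_scaleC xs ys scaleC_minus_left)
  have "cstar u * u = of_real m"
    unfolding cu unfolding u_def
    by (simp add: algebra_simps xy mult_scaleC_left mult_scaleC_right scaleC_scaleC scaleC_minus_left
        scaleC_add_right scaleC_diff_right scaleC_one x(2) y(2))
  then have norm_u: "(norm u)\<^sup>2 = m" using cstar_identity[of u] m(2) by simp
  have "2 *\<^sub>R x = u + cstar u" unfolding cu by (simp add: u_def scaleR_2)
  then have "norm (2 *\<^sub>R x) \<le> norm u + norm u" by (metis norm_cstar norm_triangle_ineq)
  then have "norm x \<le> norm u" by simp
  then have "(norm x)\<^sup>2 \<le> m" unfolding norm_u[symmetric] by (simp add: power_mono)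
  then show ?thesis using norm_square_selfadjoint[OF xs] x(2) by simp
qed

text \<open>For m the norm of \<open>p + q\<close>, the element \<open>m - p\<close> is the sum of
  the positive elements \<open>m - (p + q)\<close> and q.\<close>

lemma cpos_norm_mono:
  assumes "cpos p" "cpos q" shows "norm p \<le> norm (p + q)"
proof (rule cpos_norm_le)
  have "cpos (of_real (norm (p + q)) - (p + q))"
    by (rule cpos_norm_minus) (use assms in \<open>auto simp: cpos_def cstar_add\<close>)
  then have "cpos (of_real (norm (p + q)) - (p + q) + q)" using assms(2) by (rule cpos_add)
  then show "cpos (of_real (norm (p + q)) - p)" by (simp add: algebra_simps)
qed (use assms in auto)

text \<open>If both \<open>e = - d\<^sup>*d\<close> and \<open>r = d d\<^sup>*\<close> are positive of norm \<open>m\<close>, then \<open>(m - r) d = d (m + e)\<close>,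
  and the growth of \<open>d\<^sup>* d (m + e)\<^sup>2\<close> contradicts \<open>\<parallel>m - r\<parallel> \<le> m\<close> unless \<open>m = 0\<close>.\<close>

lemma cpos_minus_cstar_mult_self:
  fixes d :: "'a::cstar_algebra_1"
  assumes "cpos (- (cstar d * d))"
  shows "d = 0"
proof -
  define e where "e = - (cstar d * d)"
  define r where "r = d * cstar d"
  define m where "m = (norm d)\<^sup>2"
  define M where "M = (of_real m :: 'a)"
  have e: "cpos e" using assms by (simp add: e_def)
  have norm_e: "norm e = m" by (simp add: e_def m_def cstar_identity)
  have norm_r: "norm r = m" using cstar_identity[of "cstar d"] by (simp add: r_def m_def cstar_cstar)
  have M: "M * z = z * M" "norm M = m" "M * z = m *\<^sub>R z" "z * M = m *\<^sub>R z" for z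
    unfolding M_def by (simp_all add: of_real_def m_def)
  \<comment> \<open>Here \<open>d = h + i k\<close> with h and k self-adjoint, so
    \<open>cstar d * d + d * cstar d = 2 (h * h + k * k)\<close>, and r is that sum of squares plus
    e.\<close>
  have r: "cpos r"
  proof -
    define h where "h = (1 / 2 :: real) *\<^sub>R (d + cstar d)"
    define k where "k = scaleC (\<i> / 2) (cstar d - d)"
    have hs: "cstar h = h" by (simp add: h_def cstar_scaleR cstar_add cstar_cstar add.commute)
    have ks: "cstar k = k"
      by (simp add: k_def cstar_scaleC cstar_diff cstar_cstar scaleC_minus_left scaleC_diff_right)
    have "h * h + k * k = (1 / 2 :: real) *\<^sub>R (cstar d * d + d * cstar d)"
    proof -
      have "k * k = scaleC (- (1 / 4)) ((cstar d - d) * (cstar d - d))"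
        by (simp add: k_def mult_scaleC_left mult_scaleC_right scaleC_scaleC)
      also have "\<dots> = - ((1 / 4 :: real) *\<^sub>R ((cstar d - d) * (cstar d - d)))"
        using scaleC_of_real[of "1 / 4" "(cstar d - d) * (cstar d - d)"]
        by (simp add: scaleC_minus_left)
      finally have "4 *\<^sub>R (k * k) = - ((cstar d - d) * (cstar d - d))" by simp
      moreover have "4 *\<^sub>R (h * h) = (d + cstar d) * (d + cstar d)" by (simp add: h_def)
      ultimately have "4 *\<^sub>R (h * h + k * k) = 2 *\<^sub>R (cstar d * d + d * cstar d)"
        by (simp add: scaleR_add_right algebra_simps scaleR_2)
      then have "(1 / 4 :: real) *\<^sub>R 4 *\<^sub>R (h * h + k * k)
          = (1 / 4 :: real) *\<^sub>R 2 *\<^sub>R (cstar d * d + d * cstar d)" by (rule arg_cong)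
      then show ?thesis by simp
    qed
    then have "2 *\<^sub>R (h * h + k * k) + e = r"
      by (simp add: e_def r_def scaleR_add_right)
    moreover have "cpos (2 *\<^sub>R (h * h + k * k) + e)"
      by (intro cpos_add cpos_scaleR cpos_square hs ks e) simp
    ultimately show ?thesis by simp
  qed
  have "(M - r) * d = d * (M + e)"
    by (simp add: e_def r_def algebra_simps M(1)[of d])
  then have shift: "(M - r) * (M - r) * d = d * ((M + e) * (M + e))"
    by (metis mult.assoc)
  have "norm ((M - r) * (M - r) * d) \<le> m * m * norm d"
  proof -
    have "norm (M - r) \<le> m" using cpos_norm_minus_le[OF r] by (simp add: norm_r M_def)
    then have "norm ((M - r) * (M - r)) \<le> m * m"
      using norm_mult_ineq[of "M - r" "M - r"] mult_mono[of "norm (M - r)" m "norm (M - r)" m]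
      by simp
    then have "norm ((M - r) * (M - r)) * norm d \<le> m * m * norm d"
      by (rule mult_right_mono) simp
    then show ?thesis using norm_mult_ineq[of "(M - r) * (M - r)" d] by linarith
  qed
  then have "norm (e * ((M + e) * (M + e))) \<le> m * m * m"
  proof -
    assume *: "norm ((M - r) * (M - r) * d) \<le> m * m * norm d"
    have "e * ((M + e) * (M + e)) = - (cstar d * ((M - r) * (M - r) * d))"
      unfolding shift by (simp add: e_def mult.assoc)
    then have "norm (e * ((M + e) * (M + e))) \<le> norm d * norm ((M - r) * (M - r) * d)"
      using norm_mult_ineq[of "cstar d" "(M - r) * (M - r) * d"] by simp
    also have "\<dots> \<le> norm d * (m * m * norm d)" using * by (rule mult_left_mono) simp
    also have "\<dots> = m * m * m" by (simp add: m_def power2_eq_square)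
    finally show ?thesis .
  qed
  moreover have "e * ((M + e) * (M + e)) = (2 * m) *\<^sub>R (e * e) + (m\<^sup>2 *\<^sub>R e + e * e * e)"
  proof -
    have "(2 * m) *\<^sub>R (e * e) = m *\<^sub>R (e * e) + m *\<^sub>R (e * e)"
      by (simp flip: scaleR_add_left)
    then show ?thesis
      by (simp add: distrib_left distrib_right mult.assoc M(3,4) power2_eq_square
          scaleR_add_right)
  qed
  \<comment> \<open>Dropping the remainder \<open>m\<^sup>2 e + e\<^sup>3\<close>, positive because
    \<open>e\<^sup>3\<close> is the square of \<open>s\<^sup>3\<close>, leaves
    \<open>2 m\<^sup>3 \<le> m\<^sup>3\<close>.\<close>
  moreover have "norm ((2 * m) *\<^sub>R (e * e)) \<le> norm ((2 * m) *\<^sub>R (e * e) + (m\<^sup>2 *\<^sub>R e + e * e * e))"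
  proof (rule cpos_norm_mono)
    have es: "cstar e = e" using e by (simp add: cpos_def)
    obtain s where s: "cpos s" "s * s = e" using cpos_sqrt[OF e] by blast
    have "cpos (s * s * s * (s * s * s))"
      by (intro cpos_square) (use s(1) in \<open>simp add: cpos_def cstar_mult mult.assoc\<close>)
    then have "cpos (e * e * e)" by (simp add: mult.assoc flip: s(2))
    then show "cpos (m\<^sup>2 *\<^sub>R e + e * e * e)" by (intro cpos_add cpos_scaleR e) auto
    show "cpos ((2 * m) *\<^sub>R (e * e))"
      by (intro cpos_scaleR cpos_square es) (simp add: m_def)
  qed
  moreover have "norm ((2 * m) *\<^sub>R (e * e)) = 2 * m * m * m"
    using norm_square_selfadjoint[of e] e norm_e by (simp add: cpos_def m_def power2_eq_square)
  ultimately have "2 * m * m * m \<le> m * m * m" by (metis order.trans)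
  then have "m * m * m \<le> 0" by linarith
  then have "m = 0" by (simp add: m_def power2_eq_square mult_le_0_iff)
  then show ?thesis by (simp add: m_def)
qed

text \<open>Fukamiya's theorem. With \<open>b = sqrt (a\<^sup>2)\<close> and \<open>w = b - a\<close>, twice the negative part of
  \<open>a = c\<^sup>*c\<close>, the element \<open>d = c w\<close> satisfies \<open>d\<^sup>*d = w a w = - w\<^sup>3 / 2 \<le> 0\<close>.\<close>

proposition cpos_cstar_mult_self: "cpos (cstar c * c)" for c :: "'a::cstar_algebra_1"
proof -
  define a where "a = cstar c * c"
  have as: "cstar a = a" by (simp add: a_def cstar_mult cstar_cstar)
  obtain b where b: "cpos b" "b * b = a * a" "\<And>z. z * (a * a) = (a * a) * z \<Longrightarrow> z * b = b * z"
    using cpos_sqrt[OF cpos_square[OF as]] by blast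
  have ab: "a * b = b * a" by (rule b(3)) (simp add: mult.assoc)
  have bs: "cstar b = b" using b(1) by (simp add: cpos_def)
  define w where "w = b - a"
  have ws: "cstar w = w" by (simp add: w_def cstar_diff as bs)
  have wb: "w * b = b * w" by (simp add: w_def algebra_simps ab)
  obtain h where h: "cpos h" "h * h = b" "\<And>z. z * b = b * z \<Longrightarrow> z * h = h * z"
    using cpos_sqrt[OF b(1)] by blast
  have hs: "cstar h = h" using h(1) by (simp add: cpos_def)
  have wh: "w * h = h * w" by (rule h(3)[OF wb])
  have ww: "w * w = 2 *\<^sub>R (b * w)"
    by (simp add: w_def algebra_simps ab b(2) scaleR_2)
  have "w * a = w * b - w * w" by (simp add: w_def algebra_simps)
  then have wa: "w * a = - (b * w)" by (simp add: ww wb scaleR_2)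
  have "cstar (c * w) * (c * w) = w * a * w" by (simp add: cstar_mult ws a_def mult.assoc)
  also have "\<dots> = - (h * w * (h * w))"
  proof -
    have "h * w * (h * w) = h * (w * h) * w" by (simp add: mult.assoc)
    also have "\<dots> = h * h * w * w" by (simp add: wh mult.assoc)
    finally show ?thesis unfolding wa by (simp add: h(2))
  qed
  finally have "- (cstar (c * w) * (c * w)) = h * w * (h * w)" by simp
  moreover have "cpos (h * w * (h * w))"
    by (rule cpos_square) (simp add: cstar_mult hs ws wh)
  ultimately have "c * w = 0" using cpos_minus_cstar_mult_self by metis
  \<comment> \<open>Since \<open>w * w = 2 (b * w)\<close> and \<open>b * w = - (w * a)\<close>,
    this forces \<open>w = 0\<close>, that is, a equals its absolute value b.\<close>
  then have "a * w = 0" by (simp add: a_def mult.assoc)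
  moreover have "w * a = a * w" by (simp add: w_def algebra_simps ab)
  ultimately have "w * w = 0" using wa ww by simp
  then have "w = 0" using norm_square_selfadjoint[OF ws] by simp
  then show ?thesis using b(1) by (simp add: w_def a_def)
qed

text \<open>The embedding into the unitization is isometric and respects products and
  \<open>cstar\<close>. From here on, positivity in B enters only through this inequality.\<close>

proposition norm_cstar_mult_self_mono:
  fixes c d :: "'a::cstar_algebra"
  shows "norm (cstar c * c) \<le> norm (cstar c * c + cstar d * d)"
proof -
  let ?C = "Unitization c 0" and ?D = "Unitization d 0"
  have "norm (cstar ?C * ?C) \<le> norm (cstar ?C * ?C + cstar ?D * ?D)"
    by (intro cpos_norm_mono cpos_cstar_mult_self)
  then show ?thesis
    by (simp add: cstar_unitization_def times_unitization_def plus_unitization_def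
        norm_Unitization_alg)
qed

subsection \<open>The norm of a Hilbert module\<close>

locale hilbert_mod =
  fixes H :: "('e::ab_group_add, 'b::cstar_algebra) hmod"
  assumes hilbert_module: "hilbert_module H"
begin

abbreviation ip :: "'e \<Rightarrow> 'e \<Rightarrow> 'b" where "ip \<equiv> hm_inner H"
abbreviation nrm :: "'e \<Rightarrow> real" where "nrm \<equiv> hnorm H"
abbreviation sc :: "complex \<Rightarrow> 'e \<Rightarrow> 'e" where "sc \<equiv> hm_scal H"
abbreviation act :: "'e \<Rightarrow> 'b \<Rightarrow> 'e" where "act \<equiv> hm_act H"

lemma
  shows sc_add_right [rule_format]: "\<forall>c x y. sc c (x + y) = sc c x + sc c y"
    and sc_add_left [rule_format]: "\<forall>c d x. sc (c + d) x = sc c x + sc d x"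
    and sc_sc [rule_format]: "\<forall>c d x. sc c (sc d x) = sc (c * d) x"
    and sc_one [rule_format, simp]: "\<forall>x. sc 1 x = x"
    and act_add_left [rule_format]: "\<forall>x y a. act (x + y) a = act x a + act y a"
    and ip_add_right [rule_format]: "\<forall>x y z. ip x (y + z) = ip x y + ip x z"
    and ip_sc_right [rule_format]: "\<forall>c x y. ip x (sc c y) = scaleC c (ip x y)"
    and ip_act_right [rule_format]: "\<forall>x y a. ip x (act y a) = ip x y * a"
    and ip_commute [rule_format]: "\<forall>x y. ip y x = cstar (ip x y)"
    and ip_positive [rule_format]: "\<forall>x. cstar_positive (ip x x)"
    and ip_self_zero [rule_format]: "\<forall>x. ip x x = 0 \<longrightarrow> x = 0"
    and complete [rule_format]: "\<forall>xs. hcauchy H xs \<longrightarrow> (\<exists>x. hconv H xs x)"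
  using hilbert_module unfolding hilbert_module_def by - (elim conjE, assumption)+

lemma ip_add_left: "ip (x + y) z = ip x z + ip y z"
  by (metis ip_commute ip_add_right cstar_add)

lemma ip_sc_left: "ip (sc c x) y = scaleC (cnj c) (ip x y)"
  by (metis ip_commute ip_sc_right cstar_scaleC)

lemma ip_act_left: "ip (act x a) y = cstar a * ip x y"
  by (metis ip_commute ip_act_right cstar_mult)

lemma ip_zero_right [simp]: "ip x 0 = 0"
  using ip_add_right[of x 0 0] by simp

lemma ip_zero_left [simp]: "ip 0 x = 0"
  using ip_add_left[of 0 0 x] by simp

lemma ip_minus_right: "ip x (- y) = - ip x y"
  using ip_add_right[of x "- y" y] by (simp add: eq_neg_iff_add_eq_0)

lemma ip_minus_left: "ip (- x) y = - ip x y"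
  using ip_add_left[of "- x" x y] by (simp add: eq_neg_iff_add_eq_0)

lemma ip_diff_right: "ip x (y - z) = ip x y - ip x z"
  using ip_add_right[of x y "- z"] by (simp add: ip_minus_right)

lemma ip_diff_left: "ip (x - y) z = ip x z - ip y z"
  using ip_add_left[of x "- y" z] by (simp add: ip_minus_left)

lemmas ip_simps = ip_add_left ip_add_right ip_diff_left ip_diff_right ip_minus_left ip_minus_right
  ip_sc_left ip_sc_right

lemma ip_of_real_left: "ip (sc (complex_of_real r) x) y = r *\<^sub>R ip x y"
  by (simp add: ip_sc_left scaleC_of_real)

lemma ip_of_real_right: "ip x (sc (complex_of_real r) y) = r *\<^sub>R ip x y"
  by (simp add: ip_sc_right scaleC_of_real)

lemma sc_zero_left [simp]: "sc 0 x = 0"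
  using sc_add_left[of 0 0 x] by simp

lemma sc_zero_right [simp]: "sc c 0 = 0"
  using sc_add_right[of c 0 0] by simp

lemma sc_minus_left: "sc (- c) x = - sc c x"
  using sc_add_left[of "- c" c x] by (simp add: eq_neg_iff_add_eq_0)

lemma sc_minus_right: "sc c (- x) = - sc c x"
  using sc_add_right[of c "- x" x] by (simp add: eq_neg_iff_add_eq_0)

lemma sc_diff_right: "sc c (x - y) = sc c x - sc c y"
  using sc_add_right[of c x "- y"] by (simp add: sc_minus_right)

lemma nrm_sq: "(nrm x)\<^sup>2 = norm (ip x x)"
  by (simp add: hnorm_def)

lemma nrm_ge_0 [simp]: "0 \<le> nrm x"
  by (simp add: hnorm_def)

lemma nrm_eq_0 [simp]: "nrm x = 0 \<longleftrightarrow> x = 0"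
  using ip_self_zero[of x] by (auto simp: hnorm_def)

lemma nrm_zero [simp]: "nrm 0 = 0"
  by simp

lemma nrm_le_0 [simp]: "nrm x \<le> 0 \<longleftrightarrow> x = 0"
  using nrm_ge_0[of x] nrm_eq_0[of x] by linarith

lemma nrm_gt_0 [simp]: "0 < nrm x \<longleftrightarrow> x \<noteq> 0"
  using nrm_ge_0[of x] nrm_eq_0[of x] by linarith

lemma nrm_sc: "nrm (sc c x) = cmod c * nrm x"
proof -
  have "ip (sc c x) (sc c x) = scaleC (c * cnj c) (ip x x)"
    by (simp add: ip_simps scaleC_scaleC mult.commute)
  then show ?thesis
    by (simp add: hnorm_def norm_scaleC norm_mult real_sqrt_mult)
qed

lemma nrm_minus [simp]: "nrm (- x) = nrm x"
  by (simp add: hnorm_def ip_simps)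

lemma nrm_minus_commute: "nrm (x - y) = nrm (y - x)"
  using nrm_minus[of "x - y"] by simp

text \<open>\<open>r *\<^sub>R ip y y\<close> is the inner square of \<open>sqrt r\<close> times y.
  The lemma serves to drop a positive summand under the norm.\<close>

lemma norm_ip_le_add:
  assumes "0 \<le> r"
  shows "norm (ip x x) \<le> norm (ip x x + r *\<^sub>R ip y y)"
proof -
  have "ip (sc (of_real (sqrt r)) y) (sc (of_real (sqrt r)) y) = r *\<^sub>R ip y y"
    using assms by (simp add: ip_of_real_left ip_of_real_right)
  then have "cstar_positive (r *\<^sub>R ip y y)" using ip_positive by metis
  then show ?thesis using ip_positive[of x] norm_cstar_mult_self_mono unfolding cstar_positive_def by metis
qed

text \<open>Expand the inner square of \<open>u - y\<close> for \<open>u = x b / n\<close>, where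
  \<open>b = ip x y\<close> and n is the square of \<open>nrm x\<close>. The cross terms amount to
  \<open>2 / n\<close> times \<open>cstar b * b\<close>, and the square of u costs at most half of
  that in norm.\<close>

lemma Cauchy_Schwarz: "norm (ip x y) \<le> nrm x * nrm y"
proof (cases "x = 0")
  case False
  define n where "n = (nrm x)\<^sup>2"
  have n: "n > 0" using False unfolding n_def by (meson nrm_eq_0 zero_less_power2)
  define b where "b = ip x y"
  define t where "t = 1 / n"
  define u where "u = sc (of_real t) (act x b)"
  have "ip u u = t\<^sup>2 *\<^sub>R (cstar b * ip x x * b)"
    unfolding u_def ip_of_real_left ip_of_real_right ip_act_left ip_act_right
    by (simp add: mult.assoc power2_eq_square)
  then have uu: "ip u u = (1 / n\<^sup>2) *\<^sub>R (cstar b * ip x x * b)"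
    by (simp add: t_def power_divide)
  have uy: "ip u y = (1 / n) *\<^sub>R (cstar b * b)"
    unfolding u_def ip_of_real_left ip_act_left b_def[symmetric] t_def ..
  then have yu: "ip y u = (1 / n) *\<^sub>R (cstar b * b)"
    using ip_commute[of y u] by (simp add: cstar_scaleR cstar_mult cstar_cstar)
  have "(2 / n) *\<^sub>R (cstar b * b) = (1 / n) *\<^sub>R (cstar b * b) + (1 / n) *\<^sub>R (cstar b * b)"
    by (simp flip: scaleR_left_distrib)
  then have "ip (u - y) (u - y) + (2 / n) *\<^sub>R (cstar b * b) = ip y y + ip u u"
    by (simp add: ip_diff_left ip_diff_right uy yu)
  moreover obtain z where z: "ip (u - y) (u - y) = cstar z * z"
    using ip_positive unfolding cstar_positive_def by blast
  define v where "v = sqrt (2 / n) *\<^sub>R b"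
  have "cstar v * v = (2 / n) *\<^sub>R (cstar b * b)"
    using n by (simp add: v_def cstar_scaleR)
  ultimately have "norm ((2 / n) *\<^sub>R (cstar b * b)) \<le> norm (ip y y + ip u u)"
    using norm_cstar_mult_self_mono[of v z] by (simp add: z add.commute)
  also have "\<dots> \<le> norm (ip y y) + norm (ip u u)" by (rule norm_triangle_ineq)
  also have "norm (ip u u) \<le> (norm b)\<^sup>2 / n"
  proof -
    have "norm (cstar b * ip x x * b) \<le> norm b * n * norm b"
      using norm_mult_ineq[of "cstar b * ip x x" b]
        mult_right_mono[OF norm_mult_ineq[of "cstar b" "ip x x"], of "norm b"]
      by (simp add: n_def nrm_sq)
    then have "norm (ip u u) \<le> (1 / n\<^sup>2) * (norm b * n * norm b)"
      unfolding uu using n by (simp add: mult_left_mono divide_right_mono)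
    then show ?thesis using n by (simp add: power2_eq_square)
  qed
  finally have "(norm b)\<^sup>2 / n \<le> (nrm y)\<^sup>2"
    using n by (simp add: cstar_identity nrm_sq)
  then have "(norm b)\<^sup>2 \<le> (nrm x * nrm y)\<^sup>2"
    using n by (simp add: divide_le_eq n_def power_mult_distrib mult.commute)
  then show ?thesis unfolding b_def by (rule power2_le_imp_le) simp
qed simp

lemma nrm_triangle: "nrm (x + y) \<le> nrm x + nrm y"
proof -
  have "(nrm (x + y))\<^sup>2 = norm ((ip x x + ip y y) + (ip x y + ip y x))"
    by (simp add: nrm_sq ip_simps algebra_simps)
  also have "\<dots> \<le> (norm (ip x x) + norm (ip y y)) + (norm (ip x y) + norm (ip y x))"
    by (intro norm_triangle_mono order_refl)
  also have "\<dots> \<le> (nrm x + nrm y)\<^sup>2"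
    using Cauchy_Schwarz[of x y] Cauchy_Schwarz[of y x]
    by (simp add: nrm_sq[symmetric] power2_eq_square algebra_simps)
  finally show ?thesis by (rule power2_le_imp_le) simp
qed

lemma nrm_triangle_diff: "nrm (x - y) \<le> nrm x + nrm y"
  using nrm_triangle[of x "- y"] by simp

lemma nrm_triangle_le: "nrm (x - z) \<le> nrm (x - y) + nrm (y - z)"
  using nrm_triangle[of "x - y" "y - z"] by simp

lemma nrm_le_nrm_diff: "nrm x \<le> nrm y + nrm (x - y)"
  using nrm_triangle[of y "x - y"] by simp

subsection \<open>Convergence\<close>

lemma hconv_squeeze:
  assumes "\<And>n. nrm (xs n - x) \<le> f n" "f \<longlonglongrightarrow> 0" shows "hconv H xs x"
  unfolding hconv_def
  by (rule tendsto_sandwich[OF _ _ tendsto_const assms(2)]) (auto simp: assms(1))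

lemma hconv_const: "hconv H (\<lambda>_. x) x"
  by (simp add: hconv_def)

lemma hconv_add: "hconv H xs x \<Longrightarrow> hconv H ys y \<Longrightarrow> hconv H (\<lambda>n. xs n + ys n) (x + y)"
  using nrm_triangle[of "xs _ - x" "ys _ - y"]
  by (intro hconv_squeeze[where f = "\<lambda>n. nrm (xs n - x) + nrm (ys n - y)"])
    (auto simp: hconv_def algebra_simps intro: tendsto_add_zero)

lemma hconv_lipschitz:
  assumes "\<And>n. nrm (T (xs n) - T x) \<le> C * nrm (xs n - x)" "hconv H xs x"
  shows "hconv H (\<lambda>n. T (xs n)) (T x)"
  using assms by (intro hconv_squeeze[where f = "\<lambda>n. C * nrm (xs n - x)"])
    (auto simp: hconv_def intro: tendsto_mult_right_zero)

lemma hconv_sc: "hconv H xs x \<Longrightarrow> hconv H (\<lambda>n. sc c (xs n)) (sc c x)"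
  by (rule hconv_lipschitz[where C = "cmod c"]) (simp_all add: nrm_sc flip: sc_diff_right)

lemma hconv_minus: "hconv H xs x \<Longrightarrow> hconv H (\<lambda>n. - xs n) (- x)"
  using hconv_sc[of xs x "- 1"] by (simp add: sc_minus_left)

lemma hconv_diff: "hconv H xs x \<Longrightarrow> hconv H ys y \<Longrightarrow> hconv H (\<lambda>n. xs n - ys n) (x - y)"
  using hconv_add[OF _ hconv_minus, of xs x ys y] by simp

lemma tendsto_ip_left:
  assumes "hconv H xs x" shows "(\<lambda>n. ip (xs n) y) \<longlonglongrightarrow> ip x y"
proof -
  have "(\<lambda>n. nrm (xs n - x) * nrm y) \<longlonglongrightarrow> 0"
    using assms unfolding hconv_def by (rule tendsto_mult_left_zero)
  then have "(\<lambda>n. ip (xs n) y - ip x y) \<longlonglongrightarrow> 0"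
    by (rule tendsto_0_le[where K = 1]) (use Cauchy_Schwarz[of "xs _ - x" y] in
        \<open>auto intro!: eventuallyI simp: ip_diff_left abs_mult\<close>)
  then show ?thesis by (rule LIM_zero_cancel)
qed

lemma tendsto_ip_right:
  assumes "hconv H xs x" shows "(\<lambda>n. ip y (xs n)) \<longlonglongrightarrow> ip y x"
  using bounded_linear.tendsto[OF bounded_linear_cstar tendsto_ip_left[OF assms, of y]]
  by (simp flip: ip_commute)

lemma hconv_act:
  assumes "hconv H xs x" shows "hconv H (\<lambda>n. act (xs n) a) (act x a)"
proof (rule hconv_lipschitz[where C = "norm a", OF _ assms])
  fix n
  let ?z = "xs n - x"
  have "act (xs n) a - act x a = act ?z a"
    using act_add_left[of ?z x a] by simp
  moreover have "norm (cstar a * ip ?z ?z * a) \<le> norm a * norm (ip ?z ?z) * norm a"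
    using norm_mult_ineq[of "cstar a * ip ?z ?z" a]
      mult_right_mono[OF norm_mult_ineq[of "cstar a" "ip ?z ?z"], of "norm a"] by simp
  then have "(nrm (act ?z a))\<^sup>2 \<le> (norm a)\<^sup>2 * (nrm ?z)\<^sup>2"
    unfolding nrm_sq ip_act_left ip_act_right by (simp add: power2_eq_square mult_ac)
  then have "(nrm (act ?z a))\<^sup>2 \<le> (norm a * nrm ?z)\<^sup>2"
    by (simp only: power_mult_distrib)
  then have "nrm (act ?z a) \<le> norm a * nrm ?z"
    by (rule power2_le_imp_le) simp
  ultimately show "nrm (act (xs n) a - act x a) \<le> norm a * nrm ?z" by simp
qed

lemma tendsto_nrm:
  assumes "hconv H xs x" shows "(\<lambda>n. nrm (xs n)) \<longlonglongrightarrow> nrm x"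
proof -
  have "\<bar>nrm (xs n) - nrm x\<bar> \<le> nrm (xs n - x)" for n
    using nrm_le_nrm_diff[of "xs n" x] nrm_le_nrm_diff[of x "xs n"] nrm_minus_commute[of x "xs n"]
    by linarith
  then have "(\<lambda>n. nrm (xs n) - nrm x) \<longlonglongrightarrow> 0"
    using assms unfolding hconv_def by (elim tendsto_0_le[where K = 1]) (auto intro!: eventuallyI)
  then show ?thesis by (rule LIM_zero_cancel)
qed

lemma hconv_unique:
  assumes "hconv H xs x" "hconv H xs y" shows "x = y"
proof -
  have "hconv H (\<lambda>n. xs n - xs n) (x - y)" using assms by (rule hconv_diff)
  then show ?thesis by (simp add: hconv_def LIMSEQ_const_iff)
qed

lemma hconv_hcauchy:
  assumes "hconv H xs x" shows "hcauchy H xs"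
  unfolding hcauchy_def
proof (intro allI impI)
  fix e :: real assume "e > 0"
  then obtain N where N: "\<And>n. n \<ge> N \<Longrightarrow> nrm (xs n - x) < e / 2"
    using assms LIMSEQ_D[of _ 0 "e / 2"] unfolding hconv_def by fastforce
  have "nrm (xs m - xs n) < e" if "m \<ge> N" "n \<ge> N" for m n
    using nrm_triangle_le[of "xs m" "xs n" x] nrm_minus_commute[of x "xs n"] N[OF that(1)] N[OF that(2)]
    by linarith
  then show "\<exists>N. \<forall>m\<ge>N. \<forall>n\<ge>N. nrm (xs m - xs n) < e" by blast
qed

lemma hcauchy_mono:
  assumes "hcauchy H xs" "\<And>m n. c * nrm (ys m - ys n) \<le> nrm (xs m - xs n)" "c > 0"
  shows "hcauchy H ys"
  unfolding hcauchy_def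
proof (intro allI impI)
  fix e :: real assume "e > 0"
  then obtain N where "\<And>m n. m \<ge> N \<Longrightarrow> n \<ge> N \<Longrightarrow> nrm (xs m - xs n) < c * e"
    using assms(1,3) unfolding hcauchy_def by (metis mult_pos_pos)
  then have "nrm (ys m - ys n) < e" if "m \<ge> N" "n \<ge> N" for m n
    using assms(2)[of m n] assms(3) that by (metis mult_less_cancel_left_pos order_le_less_trans)
  then show "\<exists>N. \<forall>m\<ge>N. \<forall>n\<ge>N. nrm (ys m - ys n) < e" by blast
qed

lemma hdense_sequence:
  assumes "hdense H S" obtains xs where "\<And>n. xs n \<in> S" "hconv H xs x"
proof -
  have "\<forall>n. \<exists>y\<in>S. nrm (x - y) < 1 / real (Suc n)"
    using assms unfolding hdense_def by simp
  then obtain xs where xs: "\<And>n. xs n \<in> S" "\<And>n. nrm (x - xs n) < 1 / real (Suc n)" by metis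
  have "hconv H xs x"
    by (rule hconv_squeeze[OF _ LIMSEQ_Suc[OF lim_1_over_n]])
      (metis xs(2) nrm_minus_commute less_imp_le)
  with xs(1) show thesis by (rule that)
qed

lemma hdense_ip_cancel:
  assumes "hdense H S" "\<And>x. x \<in> S \<Longrightarrow> ip x y = ip x z" shows "y = z"
proof -
  obtain xs where xs: "\<And>n. xs n \<in> S" "hconv H xs (y - z)" using hdense_sequence[OF assms(1)] by blast
  have "(\<lambda>n. ip (xs n) (y - z)) \<longlonglongrightarrow> ip (y - z) (y - z)" by (rule tendsto_ip_left[OF xs(2)])
  then have "ip (y - z) (y - z) = 0"
    using assms(2)[OF xs(1)] by (simp add: ip_diff_right LIMSEQ_const_iff)
  then show ?thesis using ip_self_zero by force
qed

lemma ip_cancel: "(\<And>x. ip x y = ip x z) \<Longrightarrow> y = z"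
proof (rule hdense_ip_cancel[of UNIV])
  show "hdense H UNIV" unfolding hdense_def by (metis UNIV_I diff_self nrm_eq_0)
qed

lemma hdense_mono: "hdense H S \<Longrightarrow> S \<subseteq> S' \<Longrightarrow> hdense H S'"
  unfolding hdense_def by blast

text \<open>The explicit rate matters in the gliding-hump argument, where it is compared with the
  height of each hump.\<close>

lemma geometric_limit:
  assumes step: "\<And>n. nrm (xs (Suc n) - xs n) \<le> C * q ^ n" and q: "0 \<le> q" "q < 1"
  obtains x where "hconv H xs x" "\<And>n. nrm (x - xs n) \<le> C * q ^ n / (1 - q)"
proof -
  have C: "C \<ge> 0" using order_trans[OF nrm_ge_0 step[of 0]] by simp
  have bound: "nrm (xs (n + k) - xs n) \<le> C * q ^ n / (1 - q)" for n k
  proof -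
    have "nrm (xs (n + k) - xs n) \<le> C * q ^ n * (1 - q ^ k) / (1 - q)"
    proof (induction k)
      case (Suc k)
      have "nrm (xs (n + Suc k) - xs n) \<le> C * q ^ (n + k) + C * q ^ n * (1 - q ^ k) / (1 - q)"
        using nrm_triangle_le[of "xs (Suc (n + k))" "xs n" "xs (n + k)"] step[of "n + k"] Suc by simp
      also have "\<dots> = C * q ^ n * (1 - q ^ Suc k) / (1 - q)"
        using q by (simp add: field_simps power_add)
      finally show ?case .
    qed simp
    also have "\<dots> \<le> C * q ^ n / (1 - q)"
      using q C by (intro divide_right_mono mult_left_le) auto
    finally show ?thesis .
  qed
  have "(\<lambda>n. C * q ^ n / (1 - q)) \<longlonglongrightarrow> C * 0 / (1 - q)"
    using q by (intro tendsto_intros LIMSEQ_power_zero) auto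
  then have null: "(\<lambda>n. C * q ^ n / (1 - q)) \<longlonglongrightarrow> 0" by simp
  have "hcauchy H xs"
    unfolding hcauchy_def
  proof (intro allI impI)
    fix e :: real assume "e > 0"
    then obtain N where N: "C * q ^ N / (1 - q) < e / 2"
      using order_tendstoD(2)[OF null, of "e / 2"] by (auto simp: eventually_sequentially)
    have "nrm (xs m - xs n) < e" if "m \<ge> N" "n \<ge> N" for m n
      using nrm_triangle_le[of "xs m" "xs n" "xs N"] nrm_minus_commute[of "xs N" "xs n"]
        bound[of N "m - N"] bound[of N "n - N"] that N
      unfolding le_add_diff_inverse[OF that(1)] le_add_diff_inverse[OF that(2)] by linarith
    then show "\<exists>N. \<forall>m\<ge>N. \<forall>n\<ge>N. nrm (xs m - xs n) < e" by blast
  qed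
  then obtain x where x: "hconv H xs x" using complete by blast
  have "nrm (x - xs n) \<le> C * q ^ n / (1 - q)" for n
  proof (rule LIMSEQ_le_const2)
    show "(\<lambda>k. nrm (xs k - xs n)) \<longlonglongrightarrow> nrm (x - xs n)"
      by (intro tendsto_nrm hconv_diff x hconv_const)
    show "\<exists>N. \<forall>k\<ge>N. nrm (xs k - xs n) \<le> C * q ^ n / (1 - q)"
      using bound[of n] by (metis le_add_diff_inverse)
  qed
  with x show thesis by (rule that)
qed

lemma contraction_fixed_point:
  assumes F: "\<And>x y. nrm (F x - F y) \<le> q * nrm (x - y)" and q: "0 \<le> q" "q < 1"
  obtains x where "F x = x"
proof -
  define xs where "xs n = (F ^^ n) 0" for n
  have "nrm (xs (Suc n) - xs n) \<le> nrm (F 0) * q ^ n" for n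
  proof (induction n)
    case (Suc n)
    then show ?case
      using F[of "xs (Suc n)" "xs n"] q mult_left_mono[OF Suc, of q] by (simp add: xs_def algebra_simps)
  qed (simp add: xs_def)
  then obtain x where x: "hconv H xs x" using geometric_limit q by blast
  have "hconv H (\<lambda>n. F (xs n)) (F x)" by (rule hconv_lipschitz[OF F x])
  moreover have "hconv H (\<lambda>n. F (xs n)) x"
    using LIMSEQ_Suc[of "\<lambda>n. nrm (xs n - x)"] x by (simp add: hconv_def xs_def)
  ultimately have "F x = x" by (rule hconv_unique)
  then show thesis by (rule that)
qed

text \<open>Repeatedly replacing \<open>y\<close> by the residual \<open>y - r\<close> reaches any accuracy.\<close>

lemma hdense_by_contraction:
  assumes R: "0 \<in> R" "\<And>x y. x \<in> R \<Longrightarrow> y \<in> R \<Longrightarrow> x + y \<in> R"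
    and approx: "\<And>y. \<exists>r\<in>R. nrm (y - r) \<le> q * nrm y" and q: "0 \<le> q" "q < 1"
  shows "hdense H R"
  unfolding hdense_def
proof (intro allI impI)
  fix y and e :: real assume e: "e > 0"
  have iter: "\<exists>r\<in>R. nrm (y - r) \<le> q ^ n * nrm y" for n
  proof (induction n)
    case (Suc n)
    then obtain r where r: "r \<in> R" "nrm (y - r) \<le> q ^ n * nrm y" by blast
    obtain s where s: "s \<in> R" "nrm (y - r - s) \<le> q * nrm (y - r)" using approx by blast
    have "nrm (y - (r + s)) \<le> q ^ Suc n * nrm y"
      using s(2) mult_left_mono[OF r(2) q(1)] by (simp add: diff_diff_eq mult.assoc)
    then show ?case using R(2)[OF r(1) s(1)] by blast
  qed (use R(1) in \<open>auto intro!: bexI[of _ 0]\<close>)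
  have null: "(\<lambda>n. q ^ n * nrm y) \<longlonglongrightarrow> 0"
    using q by (intro tendsto_mult_left_zero LIMSEQ_power_zero) auto
  then obtain n where "q ^ n * nrm y < e"
    using order_tendstoD(2)[OF null e] by (auto simp: eventually_sequentially)
  then show "\<exists>r\<in>R. nrm (y - r) < e" using iter[of n] by (meson order_le_less_trans)
qed

subsection \<open>The method of continuity\<close>

text \<open>Let S be a right inverse of A; it is Lipschitz with constant \<open>1 / c\<close>. Then
  \<open>S v\<close> is a solution for the fixed point v of the contraction sending v to
  \<open>y - B (S v)\<close>.\<close>

lemma surj_perturb:
  assumes A: "\<And>x y. x \<in> V \<Longrightarrow> y \<in> V \<Longrightarrow> x - y \<in> V \<and> A (x - y) = A x - A y \<and> B (x - y) = B x - B y"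
    and b: "\<And>x. x \<in> V \<Longrightarrow> nrm (B x) \<le> b * nrm x"
    and c: "\<And>x. x \<in> V \<Longrightarrow> c * nrm x \<le> nrm (A x)"
    and bc: "0 \<le> b" "b < c"
    and surj: "\<And>y. \<exists>x\<in>V. A x = y"
  shows "\<exists>x\<in>V. A x + B x = y"
proof -
  from surj obtain S where S: "\<And>y. S y \<in> V" "\<And>y. A (S y) = y" by metis
  have S_lip: "c * nrm (S y - S z) \<le> nrm (y - z)" for y z
    using c[of "S y - S z"] A[OF S(1) S(1), of y z] by (simp add: S(2))
  have "nrm (S (y - B (S u)) - S (y - B (S v))) \<le> (b / c) * nrm (S u - S v)" for u v
  proof -
    have "c * nrm (S (y - B (S u)) - S (y - B (S v))) \<le> nrm (B (S v) - B (S u))"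
      using S_lip[of "y - B (S u)" "y - B (S v)"] by simp
    also have "\<dots> \<le> b * nrm (S v - S u)"
      using A[OF S(1) S(1), of v u] b[of "S v - S u"] by simp
    finally show ?thesis
      using bc nrm_minus_commute[of "S u" "S v"] by (simp add: field_simps)
  qed
  define F where "F v = y - B (S v)" for v
  have "nrm (F u - F v) \<le> (b / c) * nrm (u - v)" for u v
  proof -
    have "nrm (F u - F v) \<le> b * nrm (S v - S u)"
      using A[OF S(1) S(1), of v u] b[of "S v - S u"] by (simp add: F_def)
    also have "\<dots> \<le> b * (nrm (u - v) / c)"
      using S_lip[of v u] bc nrm_minus_commute[of v u] by (intro mult_left_mono) (auto simp: field_simps)
    finally show ?thesis by simp
  qed
  moreover have "0 \<le> b / c" "b / c < 1" using bc by auto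
  ultimately obtain v where "F v = v" using contraction_fixed_point by metis
  then have "A (S v) + B (S v) = y" by (simp add: F_def S(2)) (metis diff_add_cancel)
  then show ?thesis using S(1) by blast
qed

text \<open>Surjectivity is carried from t = 0 to t = 1 in N equal steps. The lower bound c is the
  same for all t, so each step is a perturbation of size \<open>b / N < c\<close>.\<close>

lemma method_of_continuity:
  assumes A: "\<And>x y. x \<in> V \<Longrightarrow> y \<in> V \<Longrightarrow> x - y \<in> V \<and> A (x - y) = A x - A y \<and> B (x - y) = B x - B y"
    and b: "\<And>x. x \<in> V \<Longrightarrow> nrm (B x) \<le> b * nrm x" "0 \<le> b"
    and c: "\<And>x t. x \<in> V \<Longrightarrow> 0 \<le> t \<Longrightarrow> t \<le> 1 \<Longrightarrow> c * nrm x \<le> nrm (A x + sc (of_real t) (B x))" "0 < c"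
    and surj: "\<And>y. \<exists>x\<in>V. A x = y"
  shows "\<exists>x\<in>V. A x + B x = y"
proof -
  obtain N :: nat where N: "b / c < real N" "N > 0"
    using reals_Archimedean2[of "b / c"] b(2) c(2) by (metis divide_nonneg_pos of_nat_0 gr0I not_less)
  have "\<forall>y. \<exists>x\<in>V. A x + sc (of_real (real n / real N)) (B x) = y" if "n \<le> N" for n
    using that
  proof (induction n)
    case 0
    then show ?case using surj by simp
  next
    case (Suc n)
    show ?case
    proof
      fix y
      have "\<exists>x\<in>V. (A x + sc (of_real (real n / real N)) (B x)) + sc (of_real (1 / real N)) (B x) = y"
      proof (rule surj_perturb[where b = "b / real N" and c = c])
        show "x - z \<in> V \<and>
          A (x - z) + sc (of_real (real n / real N)) (B (x - z)) =
            A x + sc (of_real (real n / real N)) (B x) - (A z + sc (of_real (real n / real N)) (B z)) \<and>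
          sc (of_real (1 / real N)) (B (x - z)) =
            sc (of_real (1 / real N)) (B x) - sc (of_real (1 / real N)) (B z)"
          if "x \<in> V" "z \<in> V" for x z
          using A[OF that] by (simp add: sc_diff_right)
        show "nrm (sc (of_real (1 / real N)) (B x)) \<le> b / real N * nrm x" if "x \<in> V" for x
          using b(1)[OF that] N by (simp add: nrm_sc norm_divide divide_right_mono)
        show "c * nrm x \<le> nrm (A x + sc (of_real (real n / real N)) (B x))" if "x \<in> V" for x
          using Suc.prems N by (intro c that) auto
        show "b / real N < c" using N c(2) by (simp add: field_simps)
      qed (use Suc b(2) in auto)
      moreover have "sc (of_real (real n / real N)) z + sc (of_real (1 / real N)) z
          = sc (of_real (real (Suc n) / real N)) z" for z
        by (simp add: add_divide_distrib add.commute flip: sc_add_left)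
      ultimately show "\<exists>x\<in>V. A x + sc (of_real (real (Suc n) / real N)) (B x) = y"
        by (simp add: add.assoc)
    qed
  qed
  from this[of N] show ?thesis using N by simp
qed

subsection \<open>Adjointable maps\<close>

lemma adjoint_pair_diff:
  assumes "\<And>x y. ip (T x) y = ip x (T' y)" shows "T' (x - y) = T' x - T' y"
  by (rule ip_cancel) (simp add: ip_diff_right flip: assms)

lemma adjoint_pair_sym:
  assumes "\<And>x y. ip (T x) y = ip x (T' y)" shows "ip (T' x) y = ip x (T y)"
  by (metis assms ip_commute)

text \<open>Hellinger--Toeplitz, by a gliding hump: if \<open>\<parallel>T z\<^sub>n\<parallel> > 4\<^sup>n\<close> for unit vectors \<open>z\<^sub>n\<close>, choose \<open>x\<^sub>n\<close>
  with \<open>\<parallel>x\<^sub>n\<^sub>+\<^sub>1 - x\<^sub>n\<parallel> \<le> 3\<^sup>-\<^sup>n\<close> and \<open>\<langle>T z\<^sub>n, x\<^sub>n\<^sub>+\<^sub>1\<rangle>\<close> large; the limit \<open>x\<close> then has \<open>\<langle>z\<^sub>n, T' x\<rangle>\<close> unbounded.\<close>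

proposition adjoint_pair_bounded:
  assumes adj: "\<And>x y. ip (T x) y = ip x (T' y)"
  obtains C where "C \<ge> 0" "\<And>x. nrm (T x) \<le> C * nrm x"
proof -
  have "\<exists>C. \<forall>x. nrm (T x) \<le> C * nrm x"
  proof (rule ccontr)
    assume unbounded: "\<not> ?thesis"
    have T_sc: "T (sc c x) = sc c (T x)" for c x
      by (rule ip_cancel) (metis adj adjoint_pair_sym ip_sc_right)
    have "\<exists>z. nrm z = 1 \<and> nrm (T z) > 4 ^ n" for n :: nat
    proof -
      obtain x where x: "nrm (T x) > 4 ^ n * nrm x" using unbounded by (metis not_less)
      then have "x \<noteq> 0"
        using T_sc[of 0 0] by auto
      then have "nrm x > 0" by simp
      let ?z = "sc (of_real (1 / nrm x)) x"
      have "nrm ?z = 1 \<and> nrm (T ?z) > 4 ^ n"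
        using x \<open>nrm x > 0\<close> by (auto simp add: T_sc nrm_sc norm_divide field_simps)
      then show ?thesis by blast
    qed
    then obtain z where z: "\<And>n. nrm (z n) = 1" "\<And>n. nrm (T (z n)) > 4 ^ n" by metis
    define g where "g n x = norm (ip (T (z n)) x)" for n x
    \<comment> \<open>Whatever x is, one of \<open>x + v\<close> and \<open>x - v\<close> retains
      the full hump \<open>g n v\<close>, since twice that value is at most the sum of the
      two.\<close>
    have hump: "\<exists>y. nrm (y - x) \<le> (1 / 3) ^ n \<and> g n y \<ge> (1 / 3) ^ n * nrm (T (z n))" for n x
    proof -
      let ?Tz = "T (z n)"
      define v where "v = sc (of_real ((1 / 3) ^ n / nrm ?Tz)) ?Tz"
      have pos: "nrm ?Tz > 0" using z(2)[of n] by (meson less_trans zero_less_numeral zero_less_power)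
      have nv: "nrm v = (1 / 3) ^ n"
        using pos by (simp add: v_def nrm_sc norm_divide norm_power)
      have "norm (ip ?Tz v) = ((1 / 3) ^ n / nrm ?Tz) * (nrm ?Tz)\<^sup>2"
        using pos by (simp add: v_def ip_sc_right norm_scaleC norm_divide norm_power nrm_sq)
      then have gv: "g n v = (1 / 3) ^ n * nrm ?Tz"
        using pos by (auto simp add: g_def power2_eq_square)
      have "2 *\<^sub>R ip ?Tz v = ip ?Tz (x + v) - ip ?Tz (x - v)"
        by (simp add: ip_simps scaleR_2)
      then have "2 * g n v \<le> g n (x + v) + g n (x - v)"
        using norm_triangle_ineq4[of "ip ?Tz (x + v)" "ip ?Tz (x - v)"]
        by (metis (mono_tags) abs_numeral g_def norm_scaleR)
      then consider "g n (x + v) \<ge> g n v" | "g n (x - v) \<ge> g n v" by linarith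
      then show ?thesis
      proof cases
        case 1
        then show ?thesis using gv nv by (intro exI[of _ "x + v"]) simp
      next
        case 2
        then show ?thesis using gv nv by (intro exI[of _ "x - v"]) simp
      qed
    qed
    define h where "h n x = (SOME y. nrm (y - x) \<le> (1 / 3) ^ n \<and> g n y \<ge> (1 / 3) ^ n * nrm (T (z n)))"
      for n x
    have h: "nrm (h n x - x) \<le> (1 / 3) ^ n" "g n (h n x) \<ge> (1 / 3) ^ n * nrm (T (z n))" for n x
      unfolding h_def using someI_ex[OF hump] by blast+
    define xs where "xs = rec_nat 0 h"
    have "nrm (xs (Suc n) - xs n) \<le> 1 * (1 / 3) ^ n" for n by (simp add: xs_def h)
    then obtain x where x: "\<And>n. nrm (x - xs n) \<le> 1 * (1 / 3) ^ n / (1 - 1 / 3)"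
      by (rule geometric_limit) auto
    \<comment> \<open>After step n the sequence moves by at most
      \<open>(1/3)^(n+1) / (1 - 1/3)\<close>, which is half of \<open>(1/3)^n\<close>; so half of
      the n-th hump survives in the limit.\<close>
    have "(4 / 3) ^ n / 2 \<le> nrm (T' x)" for n
    proof -
      let ?Tz = "T (z n)"
      have "nrm (x - xs (Suc n)) \<le> (1 / 3) ^ n / 2" using x[of "Suc n"] by simp
      then have "nrm ?Tz * nrm (x - xs (Suc n)) \<le> nrm ?Tz * ((1 / 3) ^ n / 2)"
        by (rule mult_left_mono) simp
      then have "g n (x - xs (Suc n)) \<le> (1 / 3) ^ n * nrm ?Tz / 2"
        using Cauchy_Schwarz[of ?Tz "x - xs (Suc n)"] by (simp add: g_def mult.commute)
      moreover have "g n (xs (Suc n)) \<ge> (1 / 3) ^ n * nrm ?Tz" using h(2) by (simp add: xs_def)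
      moreover have "g n (xs (Suc n)) \<le> g n x + g n (x - xs (Suc n))"
        using norm_triangle_ineq4[of "ip ?Tz x" "ip ?Tz (x - xs (Suc n))"]
        by (simp add: g_def ip_diff_right)
      moreover have "g n x \<le> nrm (T' x)"
        using Cauchy_Schwarz[of "z n" "T' x"] by (simp add: g_def adj z(1))
      moreover have "(1 / 3) ^ n * 4 ^ n \<le> (1 / 3) ^ n * nrm ?Tz"
        using z(2)[of n] by (intro mult_left_mono) auto
      moreover have "(1 / 3 :: real) ^ n * 4 ^ n = (4 / 3) ^ n" by (simp flip: power_mult_distrib)
      ultimately show ?thesis by linarith
    qed
    moreover obtain n where "2 * nrm (T' x) < (4 / 3) ^ n"
      using real_arch_pow[of "4 / 3" "2 * nrm (T' x)"] by auto
    ultimately show False by (metis less_divide_eq_numeral1(1) mult.commute not_less)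
  qed
  then obtain C where "\<And>x. nrm (T x) \<le> C * nrm x" by blast
  then have "nrm (T x) \<le> max C 0 * nrm x" for x
    by (meson max.cobounded1 mult_right_mono nrm_ge_0 order_trans)
  then show thesis by (intro that[of "max C 0"]) auto
qed

subsection \<open>Symmetric operators\<close>

lemma is_operatorD:
  assumes "is_operator H S"
  shows operator_zero: "0 \<in> dom_op S" "app S 0 = 0"
    and operator_add: "x \<in> dom_op S \<Longrightarrow> y \<in> dom_op S \<Longrightarrow> x + y \<in> dom_op S"
      "x \<in> dom_op S \<Longrightarrow> y \<in> dom_op S \<Longrightarrow> app S (x + y) = app S x + app S y"
    and operator_sc: "x \<in> dom_op S \<Longrightarrow> sc c x \<in> dom_op S"
      "x \<in> dom_op S \<Longrightarrow> app S (sc c x) = sc c (app S x)"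
    and operator_act: "x \<in> dom_op S \<Longrightarrow> act x a \<in> dom_op S"
      "x \<in> dom_op S \<Longrightarrow> app S (act x a) = act (app S x) a"
    and operator_diff: "x \<in> dom_op S \<Longrightarrow> y \<in> dom_op S \<Longrightarrow> x - y \<in> dom_op S"
      "x \<in> dom_op S \<Longrightarrow> y \<in> dom_op S \<Longrightarrow> app S (x - y) = app S x - app S y"
proof -
  note * = assms[unfolded is_operator_def]
  show 0: "0 \<in> dom_op S" using * by blast
  then have "app S (0 + 0) = app S 0 + app S 0" using * by blast
  then show "app S 0 = 0" by simp
  show add: "x + y \<in> dom_op S" "app S (x + y) = app S x + app S y"
    if "x \<in> dom_op S" "y \<in> dom_op S" for x y using * that by blast+
  show sc: "sc c x \<in> dom_op S" "app S (sc c x) = sc c (app S x)" if "x \<in> dom_op S" for c x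
    using * that by blast+
  show "act x a \<in> dom_op S" "app S (act x a) = act (app S x) a" if "x \<in> dom_op S" for x a
    using * that by blast+
  show "x - y \<in> dom_op S" "app S (x - y) = app S x - app S y"
    if "x \<in> dom_op S" "y \<in> dom_op S" for x y
    using add[OF that(1) sc(1)[OF that(2), of "- 1"]] sc(2)[OF that(2), of "- 1"]
    by (simp_all add: sc_minus_left)
qed

lemma symmetric_opD:
  assumes "symmetric_op H S"
  shows symmetric_is_operator: "is_operator H S"
    and symmetric_dense: "hdense H (dom_op S)"
    and symmetric_ip: "x \<in> dom_op S \<Longrightarrow> y \<in> dom_op S \<Longrightarrow> ip (app S x) y = ip x (app S y)"
  using assms unfolding symmetric_op_def densely_defined_def by blast+

abbreviation im :: "real \<Rightarrow> 'e \<Rightarrow> 'e" where "im \<mu> \<equiv> sc (Complex 0 \<mu>)"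

lemma im_one_sq [simp]: "\<mu> * \<nu> = 1 \<Longrightarrow> im \<mu> (im \<nu> x) = - x"
proof -
  assume "\<mu> * \<nu> = 1"
  then have "Complex 0 \<mu> * Complex 0 \<nu> = - 1" by (simp add: complex_eq_iff)
  then show ?thesis by (simp add: sc_sc sc_minus_left)
qed

lemma im_minus: "im (- \<mu>) x = - im \<mu> x"
proof -
  have "Complex 0 (- \<mu>) = - Complex 0 \<mu>" by (simp add: complex_eq_iff)
  then show ?thesis by (simp add: sc_minus_left)
qed

lemma im_add: "im a x + im b x = im (a + b) x"
proof -
  have "Complex 0 (a + b) = Complex 0 a + Complex 0 b" by (simp add: complex_eq_iff)
  then show ?thesis by (simp add: sc_add_left)
qed

lemma ip_im_left: "ip (im \<mu> x) y = - scaleC (Complex 0 \<mu>) (ip x y)"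
proof -
  have "cnj (Complex 0 \<mu>) = - Complex 0 \<mu>" by (simp add: complex_eq_iff)
  then show ?thesis by (simp add: ip_sc_left scaleC_minus_left)
qed

lemma cmod_im [simp]: "cmod (Complex 0 \<mu>) = \<bar>\<mu>\<bar>"
  by (simp add: cmod_def)

text \<open>By symmetry the cross terms of the inner square of \<open>S x + i mu x\<close> cancel,
  leaving two positive terms of which one is dropped.\<close>

lemma symmetric_norm_mono:
  assumes "symmetric_op H S" "x \<in> dom_op S"
  shows "\<bar>\<mu>\<bar> * nrm x \<le> nrm (app S x + im \<mu> x)"
proof -
  have "ip (app S x + im \<mu> x) (app S x + im \<mu> x) = ip (im \<mu> x) (im \<mu> x) + 1 *\<^sub>R ip (app S x) (app S x)"
    using symmetric_ip[OF assms assms(2)]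
    by (simp add: ip_add_left ip_add_right ip_im_left[of \<mu> x "app S x"] ip_sc_right[of "app S x"])
  then have "norm (ip (im \<mu> x) (im \<mu> x)) \<le> norm (ip (app S x + im \<mu> x) (app S x + im \<mu> x))"
    using norm_ip_le_add[of 1 "im \<mu> x" "app S x"] by simp
  then have "nrm (im \<mu> x) \<le> nrm (app S x + im \<mu> x)"
    unfolding nrm_sq[symmetric] by (rule power2_le_imp_le) simp
  then show ?thesis by (simp add: nrm_sc)
qed

section \<open>Adjoints and closures of symmetric operators\<close>

lemma adjointI:
  assumes "hdense H (dom_op S)" "\<And>x. x \<in> dom_op S \<Longrightarrow> ip (app S x) y = ip x z"
  shows "y \<in> dom_op (adjoint H S)" "app (adjoint H S) y = z"
proof -
  show "y \<in> dom_op (adjoint H S)" unfolding adjoint_def using assms(2) by auto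
  have "(THE z. \<forall>x\<in>dom_op S. ip (app S x) y = ip x z) = z"
    using assms(2) by (intro the_equality) (auto intro: hdense_ip_cancel[OF assms(1)])
  then show "app (adjoint H S) y = z" by (simp add: adjoint_def)
qed

lemma selfadjoint_symmetric:
  assumes "selfadjoint_op H S" shows "symmetric_op H S"
proof -
  have dense: "densely_defined H S" "hdense H (dom_op S)"
    and eq: "dom_op S = dom_op (adjoint H S)" "\<And>x. x \<in> dom_op S \<Longrightarrow> app S x = app (adjoint H S) x"
    using assms unfolding selfadjoint_op_def densely_defined_def op_eq_def by auto
  have "ip (app S x) y = ip x (app S y)" if "x \<in> dom_op S" "y \<in> dom_op S" for x y
  proof -
    have "y \<in> dom_op (adjoint H S)" using eq that by simp
    then obtain z where z: "\<And>x. x \<in> dom_op S \<Longrightarrow> ip (app S x) y = ip x z"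
      by (auto simp: adjoint_def)
    then have "app S y = z" using adjointI(2)[OF dense(2)] eq(2)[OF that(2)] by simp
    with z that show ?thesis by simp
  qed
  with dense show ?thesis unfolding symmetric_op_def by blast
qed

text \<open>Symmetric operators are closable: pairing with u from the dense domain gives
  \<open>ip u y = ip (app S u) x\<close> for every such limit y. This justifies the
  \<open>THE\<close> in \<open>op_closure\<close>.\<close>

lemma symmetric_limit_unique:
  assumes S: "symmetric_op H S"
    and xs: "\<And>n. xs n \<in> dom_op S" "hconv H xs x" "hconv H (\<lambda>n. app S (xs n)) y"
    and ys: "\<And>n. ys n \<in> dom_op S" "hconv H ys x" "hconv H (\<lambda>n. app S (ys n)) z"
  shows "y = z"
proof (rule hdense_ip_cancel[OF symmetric_dense[OF S]])
  have lim: "ip u y = ip (app S u) x"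
    if "\<And>n. xs n \<in> dom_op S" "hconv H xs x" "hconv H (\<lambda>n. app S (xs n)) y" "u \<in> dom_op S"
    for u xs y
  proof -
    have "(\<lambda>n. ip u (app S (xs n))) = (\<lambda>n. ip (app S u) (xs n))"
      using symmetric_ip[OF S that(4) that(1)] by simp
    then show ?thesis
      using tendsto_ip_right[OF that(3), of u] tendsto_ip_right[OF that(2), of "app S u"]
      by (auto intro: LIMSEQ_unique)
  qed
  show "ip u y = ip u z" if "u \<in> dom_op S" for u
    using lim[OF xs that] lim[OF ys that] by simp
qed

lemma closureI:
  assumes S: "symmetric_op H S"
    and xs: "\<And>n. xs n \<in> dom_op S" "hconv H xs x" "hconv H (\<lambda>n. app S (xs n)) y"
  shows "x \<in> dom_op (op_closure H S)" "app (op_closure H S) x = y"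
proof -
  show "x \<in> dom_op (op_closure H S)" unfolding op_closure_def using xs by auto
  have "(THE y. \<exists>xs. (\<forall>n. xs n \<in> dom_op S) \<and> hconv H xs x \<and> hconv H (\<lambda>n. app S (xs n)) y) = y"
  proof (rule the_equality)
    show "\<exists>xs. (\<forall>n. xs n \<in> dom_op S) \<and> hconv H xs x \<and> hconv H (\<lambda>n. app S (xs n)) y"
      using xs by blast
  qed (use symmetric_limit_unique[OF S _ _ _ xs] in blast)
  then show "app (op_closure H S) x = y" by (simp add: op_closure_def)
qed

lemma closureE:
  assumes "symmetric_op H S" "x \<in> dom_op (op_closure H S)"
  obtains xs where "\<And>n. xs n \<in> dom_op S" "hconv H xs x"
    "hconv H (\<lambda>n. app S (xs n)) (app (op_closure H S) x)"
proof -
  obtain xs y where xs: "\<And>n. xs n \<in> dom_op S" "hconv H xs x" "hconv H (\<lambda>n. app S (xs n)) y"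
    using assms(2) unfolding op_closure_def by auto
  with closureI(2)[OF assms(1) xs] show thesis by (intro that[of xs]) auto
qed

lemma closure_extends:
  assumes "symmetric_op H S" "x \<in> dom_op S"
  shows "x \<in> dom_op (op_closure H S)" "app (op_closure H S) x = app S x"
  using closureI[OF assms(1), where xs = "\<lambda>_. x", OF assms(2) hconv_const hconv_const] by auto

lemma closed_opD:
  assumes "closed_op H S" "\<And>n. xs n \<in> dom_op S" "hconv H xs x" "hconv H (\<lambda>n. app S (xs n)) y"
  shows "x \<in> dom_op S" "app S x = y"
  using assms unfolding closed_op_def by blast+

lemma closure_of_closed:
  assumes "symmetric_op H S" "closed_op H S" shows "op_eq (op_closure H S) S"
proof -
  have "dom_op (op_closure H S) \<subseteq> dom_op S"
    using closureE[OF assms(1)] closed_opD(1)[OF assms(2)] by (metis subsetI)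
  then show ?thesis using closure_extends[OF assms(1)] unfolding op_eq_def by auto
qed

lemma closure_symmetric:
  assumes S: "symmetric_op H S" shows "symmetric_op H (op_closure H S)"
proof -
  let ?T = "op_closure H S"
  note op = is_operatorD[OF symmetric_is_operator[OF S]]
  have "is_operator H ?T"
    unfolding is_operator_def
  proof (intro conjI ballI allI)
    show "0 \<in> dom_op ?T" using closure_extends(1)[OF S op(1)] .
  next
    fix x y assume "x \<in> dom_op ?T" "y \<in> dom_op ?T"
    then obtain xs ys where xs: "\<And>n. xs n \<in> dom_op S" "hconv H xs x" "hconv H (\<lambda>n. app S (xs n)) (app ?T x)"
      and ys: "\<And>n. ys n \<in> dom_op S" "hconv H ys y" "hconv H (\<lambda>n. app S (ys n)) (app ?T y)"
      using closureE[OF S] by metis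
    have "hconv H (\<lambda>n. app S (xs n + ys n)) (app ?T x + app ?T y)"
      using hconv_add[OF xs(3) ys(3)] by (simp add: op(4) xs(1) ys(1))
    from closureI[OF S _ hconv_add[OF xs(2) ys(2)] this] xs(1) ys(1)
    show "x + y \<in> dom_op ?T" "app ?T (x + y) = app ?T x + app ?T y" by (simp_all add: op(3))
  next
    fix x c assume "x \<in> dom_op ?T"
    then obtain xs where xs: "\<And>n. xs n \<in> dom_op S" "hconv H xs x" "hconv H (\<lambda>n. app S (xs n)) (app ?T x)"
      using closureE[OF S] by metis
    have "hconv H (\<lambda>n. app S (sc c (xs n))) (sc c (app ?T x))"
      using hconv_sc[OF xs(3)] by (simp add: op(6) xs(1))
    from closureI[OF S _ hconv_sc[OF xs(2)] this] xs(1)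
    show "sc c x \<in> dom_op ?T" "app ?T (sc c x) = sc c (app ?T x)" by (simp_all add: op(5))
  next
    fix x a assume "x \<in> dom_op ?T"
    then obtain xs where xs: "\<And>n. xs n \<in> dom_op S" "hconv H xs x" "hconv H (\<lambda>n. app S (xs n)) (app ?T x)"
      using closureE[OF S] by metis
    have "hconv H (\<lambda>n. app S (act (xs n) a)) (act (app ?T x) a)"
      using hconv_act[OF xs(3)] by (simp add: op(8) xs(1))
    from closureI[OF S _ hconv_act[OF xs(2)] this] xs(1)
    show "act x a \<in> dom_op ?T" "app ?T (act x a) = act (app ?T x) a" by (simp_all add: op(7))
  qed
  moreover have "hdense H (dom_op ?T)"
    using symmetric_dense[OF S] closure_extends(1)[OF S] by (blast intro: hdense_mono)
  moreover have "ip (app ?T x) y = ip x (app ?T y)" if xy: "x \<in> dom_op ?T" "y \<in> dom_op ?T" for x y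
  proof -
    from xy obtain xs ys where xs: "\<And>n. xs n \<in> dom_op S" "hconv H xs x" "hconv H (\<lambda>n. app S (xs n)) (app ?T x)"
      and ys: "\<And>n. ys n \<in> dom_op S" "hconv H ys y" "hconv H (\<lambda>n. app S (ys n)) (app ?T y)"
      using closureE[OF S] by metis
    have half: "ip (app ?T x) u = ip x (app S u)" if "u \<in> dom_op S" for u
      using tendsto_ip_left[OF xs(3), of u] tendsto_ip_left[OF xs(2), of "app S u"]
        symmetric_ip[OF S xs(1) that] LIMSEQ_unique by simp
    show ?thesis
      using tendsto_ip_right[OF ys(2), of "app ?T x"] tendsto_ip_right[OF ys(3), of x]
        half[OF ys(1)] LIMSEQ_unique by simp
  qed
  ultimately show ?thesis unfolding symmetric_op_def densely_defined_def by blast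
qed

text \<open>Each term is replaced by an element of \<open>dom_op S\<close> that is closer than
  \<open>1 / (n + 1)\<close> both in value and in image.\<close>

lemma closure_closed:
  assumes S: "symmetric_op H S" shows "closed_op H (op_closure H S)"
  unfolding closed_op_def
proof (intro allI impI, elim conjE)
  let ?T = "op_closure H S"
  fix xs x y
  assume xs: "\<forall>n. xs n \<in> dom_op ?T" "hconv H xs x" "hconv H (\<lambda>n. app ?T (xs n)) y"
  have "\<exists>u. u \<in> dom_op S \<and> nrm (u - xs n) < 1 / real (Suc n)
      \<and> nrm (app S u - app ?T (xs n)) < 1 / real (Suc n)" for n
  proof -
    obtain us where us: "\<And>k. us k \<in> dom_op S" "hconv H us (xs n)"
      "hconv H (\<lambda>k. app S (us k)) (app ?T (xs n))" using closureE[OF S] xs(1) by metis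
    have "eventually (\<lambda>k. nrm (us k - xs n) < 1 / real (Suc n)) sequentially"
      "eventually (\<lambda>k. nrm (app S (us k) - app ?T (xs n)) < 1 / real (Suc n)) sequentially"
      using us(2,3) unfolding hconv_def by (auto intro!: order_tendstoD(2))
    then have "eventually (\<lambda>k. nrm (us k - xs n) < 1 / real (Suc n)
        \<and> nrm (app S (us k) - app ?T (xs n)) < 1 / real (Suc n)) sequentially"
      by (rule eventually_conj)
    then show ?thesis using us(1) eventually_happens trivial_limit_sequentially by blast
  qed
  then obtain us where us: "\<And>n. us n \<in> dom_op S" "\<And>n. nrm (us n - xs n) < 1 / real (Suc n)"
    "\<And>n. nrm (app S (us n) - app ?T (xs n)) < 1 / real (Suc n)" by metis
  have null: "(\<lambda>n. 1 / real (Suc n)) \<longlonglongrightarrow> 0" by (rule LIMSEQ_Suc[OF lim_1_over_n])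
  have "hconv H (\<lambda>n. us n - xs n) 0"
    by (rule hconv_squeeze[OF _ null]) (use us(2) in \<open>auto intro: less_imp_le\<close>)
  then have 1: "hconv H us x" using hconv_add[OF _ xs(2)] by fastforce
  have "hconv H (\<lambda>n. app S (us n) - app ?T (xs n)) 0"
    by (rule hconv_squeeze[OF _ null]) (use us(3) in \<open>auto intro: less_imp_le\<close>)
  then have 2: "hconv H (\<lambda>n. app S (us n)) y" using hconv_add[OF _ xs(3)] by fastforce
  show "x \<in> dom_op ?T \<and> app ?T x = y" using closureI[OF S us(1) 1 2] by blast
qed

subsection \<open>The range criterion for regular self-adjoint operators\<close>

text \<open>Since \<open>\<mu>\<close> and \<open>\<nu>\<close> have the same sign, the segment
  between them keeps the distance \<open>min \<bar>\<mu>\<bar> \<bar>\<nu>\<bar>\<close> from 0, and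
  \<open>symmetric_norm_mono\<close> is uniform along it.\<close>

lemma surj_im_change:
  assumes T: "symmetric_op H T" and "\<mu> * \<nu> > 0"
    and surj: "\<And>y. \<exists>x\<in>dom_op T. app T x + im \<mu> x = y"
  shows "\<exists>x\<in>dom_op T. app T x + im \<nu> x = y"
proof -
  note op = is_operatorD[OF symmetric_is_operator[OF T]]
  have nz: "\<mu> \<noteq> 0" "\<nu> \<noteq> 0" using \<open>\<mu> * \<nu> > 0\<close> by auto
  have "\<exists>x\<in>dom_op T. (app T x + im \<mu> x) + im (\<nu> - \<mu>) x = y"
  proof (rule method_of_continuity[where b = "\<bar>\<nu> - \<mu>\<bar>" and c = "min \<bar>\<mu>\<bar> \<bar>\<nu>\<bar>"])
    show "x - z \<in> dom_op T \<and> app T (x - z) + im \<mu> (x - z) = app T x + im \<mu> x - (app T z + im \<mu> z) \<and>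
        im (\<nu> - \<mu>) (x - z) = im (\<nu> - \<mu>) x - im (\<nu> - \<mu>) z"
      if "x \<in> dom_op T" "z \<in> dom_op T" for x z
      using that by (simp add: op sc_diff_right)
    show "min \<bar>\<mu>\<bar> \<bar>\<nu>\<bar> * nrm x \<le> nrm (app T x + im \<mu> x + sc (of_real t) (im (\<nu> - \<mu>) x))"
      if x: "x \<in> dom_op T" and t: "0 \<le> t" "t \<le> 1" for x t
    proof -
      have "sc (of_real t) (im (\<nu> - \<mu>) x) = im (t * (\<nu> - \<mu>)) x"
      proof -
        have "complex_of_real t * Complex 0 (\<nu> - \<mu>) = Complex 0 (t * (\<nu> - \<mu>))"
          by (simp add: complex_eq_iff)
        then show ?thesis by (simp add: sc_sc)
      qed
      moreover have "\<mu> + t * (\<nu> - \<mu>) = (1 - t) * \<mu> + t * \<nu>" by (simp add: algebra_simps)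
      ultimately have eq: "app T x + im \<mu> x + sc (of_real t) (im (\<nu> - \<mu>) x)
          = app T x + im ((1 - t) * \<mu> + t * \<nu>) x"
        by (simp only: add.assoc im_add)
      have "min \<bar>\<mu>\<bar> \<bar>\<nu>\<bar> \<le> \<bar>(1 - t) * \<mu> + t * \<nu>\<bar>"
      proof -
        have "min \<bar>\<mu>\<bar> \<bar>\<nu>\<bar> = (1 - t) * min \<bar>\<mu>\<bar> \<bar>\<nu>\<bar> + t * min \<bar>\<mu>\<bar> \<bar>\<nu>\<bar>" by (simp add: algebra_simps)
        also have "\<dots> \<le> (1 - t) * \<bar>\<mu>\<bar> + t * \<bar>\<nu>\<bar>"
          using t by (intro add_mono mult_left_mono) auto
        also have "\<dots> = \<bar>(1 - t) * \<mu> + t * \<nu>\<bar>"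
        proof (cases "\<mu> > 0")
          case True
          then have "\<nu> > 0" using assms(2) zero_less_mult_pos by blast
          with True t show ?thesis by simp
        next
          case False
          with assms(2) nz have "\<mu> < 0" "\<nu> < 0" by (auto simp: zero_less_mult_iff)
          moreover from this t have "(1 - t) * \<mu> \<le> 0" "t * \<nu> \<le> 0"
            by (auto intro: mult_nonneg_nonpos)
          ultimately show ?thesis by simp
        qed
        finally show ?thesis .
      qed
      then show ?thesis
        unfolding eq using symmetric_norm_mono[OF T x] mult_right_mono nrm_ge_0 order_trans by blast
    qed
  qed (use surj nz in \<open>simp_all add: nrm_sc\<close>)
  then show ?thesis by (simp add: add.assoc im_add)
qed

text \<open>For y in the domain of the adjoint, solve \<open>(T + i mu) x = T* y + i mu y\<close>;
  then \<open>y - x\<close> is orthogonal to the range of \<open>T - i mu\<close>, which is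
  everything, so y = x. Regularity follows from the factorisation
  \<open>1 + T\<^sup>2 = (T + i) (T - i)\<close>, once \<open>\<mu>\<close> has been moved to
  1.\<close>

lemma selfadjoint_regular_of_surj:
  assumes T: "symmetric_op H T" "closed_op H T" and "\<mu> > 0"
    and surj: "\<And>y. \<exists>x\<in>dom_op T. app T x + im \<mu> x = y" "\<And>y. \<exists>x\<in>dom_op T. app T x + im (- \<mu>) x = y"
  shows "selfadjoint_op H T" "regular_op H T"
proof -
  note op = is_operatorD[OF symmetric_is_operator[OF T(1)]]
  have dd: "densely_defined H T" using T(1) unfolding symmetric_op_def by blast
  have sub: "y \<in> dom_op (adjoint H T) \<and> app (adjoint H T) y = app T y" if "y \<in> dom_op T" for y
    using adjointI[OF symmetric_dense[OF T(1)], of y "app T y"] symmetric_ip[OF T(1) _ that] by blast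
  have "y \<in> dom_op T" if y: "y \<in> dom_op (adjoint H T)" for y
  proof -
    obtain z where z: "\<And>u. u \<in> dom_op T \<Longrightarrow> ip (app T u) y = ip u z"
      using y by (auto simp: adjoint_def)
    obtain x where x: "x \<in> dom_op T" "app T x + im \<mu> x = z + im \<mu> y" using surj(1) by metis
    have "y = x"
    proof (rule ip_cancel)
      fix v
      obtain u where u: "u \<in> dom_op T" "app T u + im (- \<mu>) u = v" using surj(2) by metis
      have "ip v y = ip u (z + im \<mu> y)"
        unfolding u(2)[symmetric] im_minus
        by (simp add: ip_simps(1-6) ip_im_left ip_sc_right z[OF u(1)])
      moreover have "ip v x = ip u (app T x + im \<mu> x)"
        unfolding u(2)[symmetric] im_minus
        by (simp add: ip_simps(1-6) ip_im_left ip_sc_right symmetric_ip[OF T(1) u(1) x(1)])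
      ultimately show "ip v y = ip v x" by (simp add: x(2))
    qed
    with x(1) show ?thesis by simp
  qed
  then have dom: "dom_op (adjoint H T) = dom_op T" using sub by blast
  then show sa: "selfadjoint_op H T" unfolding selfadjoint_op_def op_eq_def using dd sub by auto
  have "is_operator H (adjoint H T)"
    unfolding is_operator_def dom using sub by (auto simp: op)
  then have dda: "densely_defined H (adjoint H T)"
    using dd unfolding densely_defined_def dom by blast
  have "\<exists>x. x \<in> dom_op T \<and> app T x \<in> dom_op (adjoint H T) \<and> y = x + app (adjoint H T) (app T x)" for y
  proof -
    obtain u where u: "u \<in> dom_op T" "app T u + im 1 u = y"
      using surj_im_change[OF T(1) _ surj(1), of 1] \<open>\<mu> > 0\<close> by auto
    obtain x where x: "x \<in> dom_op T" "app T x + im (- 1) x = u"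
      using surj_im_change[OF T(1) _ surj(2), of "- 1"] \<open>\<mu> > 0\<close> by auto
    have Tx: "app T x = u + im 1 x" using x(2) by (simp add: im_minus algebra_simps)
    then have "app T x \<in> dom_op T" using u(1) x(1) by (simp add: op)
    moreover have "app T (app T x) = app T u + im 1 (app T x)"
      unfolding Tx using u(1) x(1) by (simp add: op Tx)
    then have "x + app T (app T x) = y"
      unfolding Tx sc_add_right using u(2) by (simp add: algebra_simps)
    ultimately show ?thesis using x(1) sub dom by auto
  qed
  then have "hdense H {x + app (adjoint H T) (app T x) | x. x \<in> dom_op T \<and> app T x \<in> dom_op (adjoint H T)}"
    unfolding hdense_def by (metis (mono_tags, lifting) diff_self mem_Collect_eq nrm_zero)
  then show "regular_op H T" unfolding regular_op_def using dd dda T(2) by blast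
qed

text \<open>By the lower bound, preimages of a convergent sequence in the range form a Cauchy
  sequence, so dense range of \<open>S + i mu\<close> becomes surjectivity for the closure.\<close>

lemma closure_selfadjoint_regular:
  assumes S: "symmetric_op H S" and "\<mu> > 0"
    and dense: "hdense H ((\<lambda>x. app S x + im \<mu> x) ` dom_op S)" "hdense H ((\<lambda>x. app S x + im (- \<mu>) x) ` dom_op S)"
  shows "selfadjoint_op H (op_closure H S)" "regular_op H (op_closure H S)"
    "\<exists>x\<in>dom_op (op_closure H S). app (op_closure H S) x + im \<mu> x = y"
proof -
  let ?T = "op_closure H S"
  note op = is_operatorD[OF symmetric_is_operator[OF S]]
  have surj: "\<exists>x\<in>dom_op ?T. app ?T x + im \<nu> x = y"
    if "\<nu> \<noteq> 0" and dense: "hdense H ((\<lambda>x. app S x + im \<nu> x) ` dom_op S)" for \<nu> y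
  proof -
    obtain ys where ys: "\<And>n. ys n \<in> (\<lambda>x. app S x + im \<nu> x) ` dom_op S" "hconv H ys y"
      using hdense_sequence[OF dense] by blast
    have "\<forall>n. \<exists>x. x \<in> dom_op S \<and> ys n = app S x + im \<nu> x" using ys(1) by blast
    then obtain xs where xs: "\<And>n. xs n \<in> dom_op S" "\<And>n. ys n = app S (xs n) + im \<nu> (xs n)"
      by metis
    have "\<bar>\<nu>\<bar> * nrm (xs m - xs n) \<le> nrm (ys m - ys n)" for m n
    proof -
      have "app S (xs m - xs n) + im \<nu> (xs m - xs n) = ys m - ys n"
        by (simp add: xs op(10) sc_diff_right)
      then show ?thesis using symmetric_norm_mono[OF S op(9)[OF xs(1) xs(1)], of \<nu> m n] by simp
    qed
    then have "hcauchy H xs"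
      using hcauchy_mono[OF hconv_hcauchy[OF ys(2)], of "\<bar>\<nu>\<bar>" xs] \<open>\<nu> \<noteq> 0\<close> by simp
    then obtain x where x: "hconv H xs x" using complete by blast
    have "hconv H (\<lambda>n. app S (xs n)) (y - im \<nu> x)"
      using hconv_diff[OF ys(2) hconv_sc[OF x, of "Complex 0 \<nu>"]] by (simp add: xs(2))
    from closureI[OF S xs(1) x this] show ?thesis by (metis diff_add_cancel)
  qed
  have "\<mu> \<noteq> 0" "- \<mu> \<noteq> 0" using \<open>\<mu> > 0\<close> by auto
  note surj' = surj[OF this(1) dense(1)] surj[OF this(2) dense(2)]
  show "selfadjoint_op H ?T" "regular_op H ?T"
    by (rule selfadjoint_regular_of_surj[OF closure_symmetric[OF S] closure_closed[OF S] \<open>\<mu> > 0\<close> surj'])+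
  show "\<exists>x\<in>dom_op ?T. app ?T x + im \<mu> x = y" by (rule surj'(1))
qed

text \<open>\<open>1 + T\<^sup>2\<close> has dense range by regularity and bounds both x and
  \<open>T x\<close> from above, so closedness of T makes it onto. Then \<open>(T - i mu) x\<close>
  solves the equation, because \<open>mu\<^sup>2 = 1\<close>.\<close>

lemma selfadjoint_regular_surj:
  assumes T: "selfadjoint_op H T" "regular_op H T" and \<mu>: "\<mu> * \<mu> = 1"
  shows "\<exists>x\<in>dom_op T. app T x + im \<mu> x = y"
proof -
  have sym: "symmetric_op H T" by (rule selfadjoint_symmetric[OF T(1)])
  note op = is_operatorD[OF symmetric_is_operator[OF sym]]
  have closed: "closed_op H T" using T(2) unfolding regular_op_def by blast
  have eq: "dom_op (adjoint H T) = dom_op T" "\<And>x. x \<in> dom_op T \<Longrightarrow> app (adjoint H T) x = app T x"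
    using T(1) unfolding selfadjoint_op_def op_eq_def by auto
  have "{x + app (adjoint H T) (app T x) | x. x \<in> dom_op T \<and> app T x \<in> dom_op (adjoint H T)}
      = {x + app T (app T x) | x. x \<in> dom_op T \<and> app T x \<in> dom_op T}"
    by (rule Collect_cong) (metis eq)
  then have dense: "hdense H {x + app T (app T x) | x. x \<in> dom_op T \<and> app T x \<in> dom_op T}"
    using T(2) unfolding regular_op_def by simp
  obtain ws where ws: "\<And>n. ws n \<in> {x + app T (app T x) | x. x \<in> dom_op T \<and> app T x \<in> dom_op T}"
    "hconv H ws y" using hdense_sequence[OF dense] by blast
  then have "\<forall>n. \<exists>x. x \<in> dom_op T \<and> app T x \<in> dom_op T \<and> ws n = x + app T (app T x)" by blast
  then obtain xs where xs: "\<And>n. xs n \<in> dom_op T" "\<And>n. app T (xs n) \<in> dom_op T"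
    "\<And>n. ws n = xs n + app T (app T (xs n))" by metis
  have bound: "nrm x \<le> nrm (x + app T (app T x)) \<and> nrm (app T x) \<le> nrm (x + app T (app T x))"
    if x: "x \<in> dom_op T" "app T x \<in> dom_op T" for x
  proof -
    let ?w = "x + app T (app T x)"
    have xw: "ip x ?w = ip x x + 1 *\<^sub>R ip (app T x) (app T x)"
      using symmetric_ip[OF sym x] by (simp add: ip_add_right)
    then have "(nrm x)\<^sup>2 \<le> norm (ip x ?w)"
      using norm_ip_le_add[of 1 x "app T x"] by (simp add: nrm_sq)
    also have "\<dots> \<le> nrm x * nrm ?w" by (rule Cauchy_Schwarz)
    finally have 1: "nrm x \<le> nrm ?w"
      by (cases "x = 0") (simp_all add: power2_eq_square)
    have "(nrm (app T x))\<^sup>2 \<le> norm (ip x ?w)"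
      using norm_ip_le_add[of 1 "app T x" x] xw by (simp add: nrm_sq add.commute)
    also have "\<dots> \<le> nrm ?w * nrm ?w"
      using Cauchy_Schwarz[of x ?w] mult_right_mono[OF 1, of "nrm ?w"] by simp
    finally have "nrm (app T x) \<le> nrm ?w"
      by (intro power2_le_imp_le[of "nrm (app T x)"]) (simp_all add: power2_eq_square)
    with 1 show ?thesis by blast
  qed
  have diff: "nrm (xs m - xs n) \<le> nrm (ws m - ws n) \<and> nrm (app T (xs m) - app T (xs n)) \<le> nrm (ws m - ws n)" for m n
  proof -
    have "xs m - xs n + app T (app T (xs m - xs n)) = ws m - ws n"
      using xs by (simp add: op(10))
    moreover have "xs m - xs n \<in> dom_op T" "app T (xs m - xs n) \<in> dom_op T"
      "app T (xs m - xs n) = app T (xs m) - app T (xs n)"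
      using xs(1,2) by (simp_all add: op(9,10))
    ultimately show ?thesis using bound[of "xs m - xs n"] by simp
  qed
  have ws_cauchy: "hcauchy H ws" by (rule hconv_hcauchy[OF ws(2)])
  have "hcauchy H xs"
    by (rule hcauchy_mono[OF ws_cauchy, where c = 1]) (simp_all add: diff)
  moreover have "hcauchy H (\<lambda>n. app T (xs n))"
    by (rule hcauchy_mono[OF ws_cauchy, where c = 1]) (simp_all add: diff)
  ultimately obtain x v where x: "hconv H xs x" and v: "hconv H (\<lambda>n. app T (xs n)) v"
    using complete by blast
  have "hconv H (\<lambda>n. app T (app T (xs n))) (y - x)"
    using hconv_diff[OF ws(2) x] by (simp add: xs(3))
  then have v': "v \<in> dom_op T" "app T v = y - x"
    using closed_opD[OF closed xs(2) v] by blast+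
  have x': "x \<in> dom_op T" "app T x = v"
    using closed_opD[OF closed xs(1) x v] by blast+
  have "app T (v - im \<mu> x) + im \<mu> (v - im \<mu> x) = y"
    using v' x' \<mu> by (simp add: op sc_diff_right)
  moreover have "v - im \<mu> x \<in> dom_op T" using v' x' by (simp add: op)
  ultimately show ?thesis by blast
qed

text \<open>Solving \<open>(T1 + i mu) u = (T2 + i mu) x\<close> puts \<open>u - x\<close> into the
  kernel of \<open>T2 + i mu\<close>, which is zero by symmetry.\<close>

lemma selfadjoint_maximal:
  assumes T1: "\<And>y. \<exists>x\<in>dom_op T1. app T1 x + im \<mu> x = y" and "\<mu> > 0" and T2: "symmetric_op H T2"
    and sub: "\<And>x. x \<in> dom_op T1 \<Longrightarrow> x \<in> dom_op T2 \<and> app T2 x = app T1 x"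
  shows "op_eq T1 T2"
proof -
  note op = is_operatorD[OF symmetric_is_operator[OF T2]]
  have "x \<in> dom_op T1" if x: "x \<in> dom_op T2" for x
  proof -
    obtain u where u: "u \<in> dom_op T1" "app T1 u + im \<mu> u = app T2 x + im \<mu> x" using T1 by metis
    have "\<bar>\<mu>\<bar> * nrm (u - x) \<le> nrm (app T2 (u - x) + im \<mu> (u - x))"
      using sub[OF u(1)] x by (intro symmetric_norm_mono[OF T2]) (simp add: op)
    also have "app T2 (u - x) + im \<mu> (u - x) = 0"
      using sub[OF u(1)] x u(2) by (simp add: op sc_diff_right algebra_simps)
    finally have "u = x" using \<open>\<mu> > 0\<close> by (simp add: mult_le_0_iff)
    with u(1) show ?thesis by simp
  qed
  then show ?thesis unfolding op_eq_def using sub by auto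
qed

subsection \<open>Locally bounded perturbations\<close>

text \<open>The extension is described along every approximating sequence, because identities are
  later checked on the dense domain and passed to the limit.\<close>

lemma extend_bounded:
  assumes dense: "hdense H V"
    and A: "\<And>x y. x \<in> V \<Longrightarrow> y \<in> V \<Longrightarrow> x - y \<in> V \<and> A (x - y) = A x - A y"
    and bound: "\<And>x. x \<in> V \<Longrightarrow> nrm (A x) \<le> C * nrm x" and "C \<ge> 0"
  obtains A' where "\<And>x. nrm (A' x) \<le> C * nrm x"
    "\<And>xs x. (\<And>n. xs n \<in> V) \<Longrightarrow> hconv H xs x \<Longrightarrow> hconv H (\<lambda>n. A (xs n)) (A' x)"
proof -
  have cauchy: "hcauchy H (\<lambda>n. A (xs n))" if "\<And>n. xs n \<in> V" "hconv H xs x" for xs x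
  \<comment> \<open>\<open>C + 1\<close> instead of C keeps the factor finite when C = 0.\<close>
  proof (rule hcauchy_mono[OF hconv_hcauchy[OF that(2)], where c = "1 / (C + 1)"])
    fix m n
    have "nrm (A (xs m) - A (xs n)) \<le> C * nrm (xs m - xs n)"
      using bound[of "xs m - xs n"] A[OF that(1) that(1)] by metis
    also have "\<dots> \<le> (C + 1) * nrm (xs m - xs n)" by (intro mult_right_mono) auto
    finally show "1 / (C + 1) * nrm (A (xs m) - A (xs n)) \<le> nrm (xs m - xs n)"
      using \<open>C \<ge> 0\<close> by (simp add: divide_le_eq mult.commute)
  qed (use \<open>C \<ge> 0\<close> in simp)
  have "\<exists>a. \<forall>xs. (\<forall>n. xs n \<in> V) \<longrightarrow> hconv H xs x \<longrightarrow> hconv H (\<lambda>n. A (xs n)) a" for x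
  proof -
    obtain us where us: "\<And>n. us n \<in> V" "hconv H us x" using hdense_sequence[OF dense] by blast
    obtain a where a: "hconv H (\<lambda>n. A (us n)) a" using cauchy[OF us] complete by blast
    have "hconv H (\<lambda>n. A (xs n)) a" if xs: "\<And>n. xs n \<in> V" "hconv H xs x" for xs
    proof -
      have "(\<lambda>n. C * nrm (xs n - us n)) \<longlonglongrightarrow> 0"
        using hconv_diff[OF xs(2) us(2)] unfolding hconv_def
        by (intro tendsto_mult_right_zero) simp
      then have "hconv H (\<lambda>n. A (xs n) - A (us n)) 0"
      proof (rule hconv_squeeze[rotated])
        show "nrm (A (xs n) - A (us n) - 0) \<le> C * nrm (xs n - us n)" for n
          using bound[of "xs n - us n"] A[OF xs(1) us(1)] by (metis diff_zero)
      qed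
      from hconv_add[OF this a] show ?thesis by simp
    qed
    then show ?thesis by blast
  qed
  then obtain A' where A': "\<And>x xs. (\<And>n. xs n \<in> V) \<Longrightarrow> hconv H xs x \<Longrightarrow> hconv H (\<lambda>n. A (xs n)) (A' x)"
    by metis
  have "nrm (A' x) \<le> C * nrm x" for x
  proof -
    obtain us where us: "\<And>n. us n \<in> V" "hconv H us x" using hdense_sequence[OF dense] by blast
    show ?thesis
    proof (rule LIMSEQ_le[OF tendsto_nrm[OF A'[OF us]] tendsto_mult_left[OF tendsto_nrm[OF us(2)]]])
      show "\<exists>N. \<forall>n\<ge>N. nrm (A (us n)) \<le> C * nrm (us n)" using bound[OF us(1)] by blast
    qed
  qed
  then show thesis using A' by (rule that)
qed

text \<open>Approximate x from \<open>dom_op M\<close>: the images under \<open>\<phi>\<close>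
  converge, and by boundedness so do their images under M. Hence \<open>\<phi>\<close> maps the
  whole module into the domain of the closure.\<close>

lemma locally_bounded_closure:
  assumes M: "symmetric_op H M" and \<phi>: "\<And>x y. ip (\<phi> x) y = ip x (\<phi> y)"
    and \<phi>M: "\<And>x. x \<in> dom_op M \<Longrightarrow> \<phi> x \<in> dom_op M"
    and bounded: "\<And>x. x \<in> dom_op M \<Longrightarrow> nrm (app M (\<phi> x)) \<le> p * nrm x" "0 \<le> p"
  shows "\<phi> x \<in> dom_op (op_closure H M)" "nrm (app (op_closure H M) (\<phi> x)) \<le> p * nrm x"
proof -
  note opM = is_operatorD[OF symmetric_is_operator[OF M]]
  have \<phi>_diff: "\<phi> (x - y) = \<phi> x - \<phi> y" for x y by (rule adjoint_pair_diff[OF \<phi>])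
  obtain F where F: "\<And>x. nrm (\<phi> x) \<le> F * nrm x" using adjoint_pair_bounded[OF \<phi>] by blast
  have "x - y \<in> dom_op M \<and> app M (\<phi> (x - y)) = app M (\<phi> x) - app M (\<phi> y)"
    if "x \<in> dom_op M" "y \<in> dom_op M" for x y
    using that by (simp add: opM(9,10) \<phi>_diff \<phi>M)
  from extend_bounded[OF symmetric_dense[OF M] this, of p] bounded
  obtain P where P: "\<And>x. nrm (P x) \<le> p * nrm x"
    and P_lim: "\<And>xs x. (\<And>n. xs n \<in> dom_op M) \<Longrightarrow> hconv H xs x \<Longrightarrow> hconv H (\<lambda>n. app M (\<phi> (xs n))) (P x)"
    by auto
  obtain xs where xs: "\<And>n. xs n \<in> dom_op M" "hconv H xs x"
    using hdense_sequence[OF symmetric_dense[OF M]] by blast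
  have "hconv H (\<lambda>n. \<phi> (xs n)) (\<phi> x)"
    by (rule hconv_lipschitz[OF _ xs(2), where C = F]) (metis \<phi>_diff F)
  from closureI[OF M \<phi>M[OF xs(1)] this P_lim[OF xs]] P
  show "\<phi> x \<in> dom_op (op_closure H M)" "nrm (app (op_closure H M) (\<phi> x)) \<le> p * nrm x" by auto
qed

lemma adjoint_pair_sc:
  assumes "\<And>x y. ip (T x) y = ip x (T' y)" shows "T' (sc c x) = sc c (T' x)"
  by (rule ip_cancel) (simp add: ip_sc_right flip: assms)

lemma symmetric_ip_im:
  assumes "symmetric_op H S" "u \<in> dom_op S" "v \<in> dom_op S"
  shows "ip (app S u + im \<mu> u) v = ip u (app S v + im (- \<mu>) v)"
  using symmetric_ip[OF assms]
  by (simp add: ip_add_left ip_add_right ip_im_left im_minus ip_minus_right ip_diff_right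
      ip_sc_right[of u])

lemma op_sum_symmetric:
  assumes S: "symmetric_op H S" and T: "symmetric_op H T" and "hdense H (dom_op S \<inter> dom_op T)"
  shows "symmetric_op H (op_sum S T)"
proof -
  note opS = is_operatorD[OF symmetric_is_operator[OF S]]
    and opT = is_operatorD[OF symmetric_is_operator[OF T]]
  have "is_operator H (op_sum S T)"
    unfolding is_operator_def op_sum_def
    by (auto simp: opS(1,3-8) opT(1,3-8) sc_add_right act_add_left)
  then show ?thesis
    unfolding symmetric_op_def densely_defined_def
    using assms(3) by (auto simp: op_sum_def ip_add_left ip_add_right symmetric_ip[OF S] symmetric_ip[OF T])
qed

text \<open>The residual \<open>\<eta>\<close> of the Tikhonov-regularised equation \<open>G G\<^sup>* \<eta> + s \<eta> = s y\<close>, with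
  \<open>G = (D + M + i \<mu>) \<phi> (D + i)\<^sup>-\<^sup>1\<close>. As \<open>s \<rightarrow> 0\<close>, \<open>\<delta> = G\<^sup>* \<eta>\<close> tends to \<open>0\<close>, which says that \<open>\<phi> \<eta>\<close> approximately
  solves \<open>(D + M - i \<mu>) \<phi> \<eta> = [D + M, \<phi>] \<eta>\<close>; pairing with \<open>\<phi> \<eta>\<close> bounds \<open>\<mu> \<parallel>\<phi> \<eta>\<parallel>\<^sup>2\<close>.\<close>

lemma regularised_residual:
  assumes D: "selfadjoint_op H D" "regular_op H D" and M: "symmetric_op H M"
    and dense: "hdense H (dom_op D \<inter> dom_op M)"
    and \<phi>: "\<And>x y. ip (\<phi> x) y = ip x (\<phi> y)"
    and \<phi>D: "\<And>x. x \<in> dom_op D \<Longrightarrow> \<phi> x \<in> dom_op D"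
    and \<phi>M: "\<And>x. x \<in> dom_op M \<Longrightarrow> \<phi> x \<in> dom_op M"
    and comm: "\<And>x. x \<in> dom_op D \<Longrightarrow> x \<in> dom_op M \<Longrightarrow>
      nrm (app D (\<phi> x) + app M (\<phi> x) - \<phi> (app D x) - \<phi> (app M x)) \<le> C * nrm x" "0 \<le> C"
    and bounded: "\<And>x. x \<in> dom_op M \<Longrightarrow> nrm (app M (\<phi> x)) \<le> p * nrm x" "0 \<le> p"
    and "\<epsilon> > 0"
  obtains u \<eta> where "u \<in> dom_op D" "\<phi> u \<in> dom_op (op_closure H M)"
    "y - (app D (\<phi> u) + app (op_closure H M) (\<phi> u) + im \<mu> (\<phi> u)) = \<eta>"
    "(nrm \<eta>)\<^sup>2 \<le> norm (ip \<eta> y)" "\<bar>\<mu>\<bar> * (nrm (\<phi> \<eta>))\<^sup>2 \<le> C * nrm (\<phi> \<eta>) * nrm \<eta> + \<epsilon>"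
proof -
  let ?M = "op_closure H M" and ?V = "dom_op D \<inter> dom_op M"
  have Ds: "symmetric_op H D" by (rule selfadjoint_symmetric[OF D(1)])
  have Ms: "symmetric_op H ?M" by (rule closure_symmetric[OF M])
  note opD = is_operatorD[OF symmetric_is_operator[OF Ds]]
    and opM = is_operatorD[OF symmetric_is_operator[OF M]]
  have \<phi>_diff: "\<phi> (x - y) = \<phi> x - \<phi> y" for x y by (rule adjoint_pair_diff[OF \<phi>])
  obtain F where F: "F \<ge> 0" "\<And>x. nrm (\<phi> x) \<le> F * nrm x" using adjoint_pair_bounded[OF \<phi>] by blast
  have \<phi>_conv: "hconv H (\<lambda>n. \<phi> (xs n)) (\<phi> x)" if "hconv H xs x" for xs x
    by (rule hconv_lipschitz[OF _ that, where C = F]) (metis \<phi>_diff F(2))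

  define c where "c x = app D (\<phi> x) + app M (\<phi> x) - \<phi> (app D x) - \<phi> (app M x)" for x
  note M\<phi> = locally_bounded_closure[OF M \<phi> \<phi>M bounded]
  define P where "P x = app ?M (\<phi> x)" for x
  have P: "nrm (P x) \<le> p * nrm x" for x unfolding P_def by (rule M\<phi>(2))
  have P_lim: "hconv H (\<lambda>n. app M (\<phi> (xs n))) (P x)"
    if "\<And>n. xs n \<in> ?V" "hconv H xs x" for xs x
  proof -
    have "hconv H (\<lambda>n. P (xs n)) (P x)"
      by (rule hconv_lipschitz[OF _ that(2), where C = p])
        (metis M\<phi>(1) P P_def \<phi>_diff operator_diff(2)[OF symmetric_is_operator[OF Ms]])
    then show ?thesis using closure_extends(2)[OF M \<phi>M] that(1) by (simp add: P_def)
  qed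
  have "x - y \<in> ?V \<and> c (x - y) = c x - c y" if "x \<in> ?V" "y \<in> ?V" for x y
    using that by (simp add: c_def opD(9,10) opM(9,10) \<phi>_diff \<phi>M \<phi>D algebra_simps)
  from extend_bounded[OF dense this, of C] comm obtain K where K: "\<And>x. nrm (K x) \<le> C * nrm x"
    and K_lim: "\<And>xs x. (\<And>n. xs n \<in> ?V) \<Longrightarrow> hconv H xs x \<Longrightarrow> hconv H (\<lambda>n. c (xs n)) (K x)"
    by (auto simp: c_def)
  obtain Rp where Rp: "\<And>z. Rp z \<in> dom_op D" "\<And>z. app D (Rp z) + im 1 (Rp z) = z"
    using selfadjoint_regular_surj[OF D, where \<mu> = 1] by (metis mult_1)
  obtain Rm where Rm: "\<And>z. Rm z \<in> dom_op D" "\<And>z. app D (Rm z) + im (- 1) (Rm z) = z"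
    using selfadjoint_regular_surj[OF D, where \<mu> = "- 1"] by (metis minus_mult_minus mult_1)
  have R: "ip (Rp z) w = ip z (Rm w)" for z w
    using symmetric_ip_im[OF Ds Rp(1)[of z] Rm(1)[of w], where \<mu> = 1] by (simp only: Rp(2) Rm(2))
  have DRp: "app D (Rp z) = z - im 1 (Rp z)" for z using Rp(2)[of z] by (simp add: eq_diff_eq)
  have DRm: "app D (Rm z) = z + im 1 (Rm z)" for z using Rm(2)[of z] by (simp add: im_minus diff_eq_eq)

  \<comment> \<open>On the common domain,
    \<open>\<phi> (D + M - i mu) \<eta> = D \<phi> \<eta> + w \<eta>\<close>, with everything
    bounded gathered in w. Applying \<open>(D - i)^-1\<close> to the right-hand side gives
    \<open>G'\<close>.\<close>
  define w where "w \<eta> = P \<eta> - K \<eta> - im \<mu> (\<phi> \<eta>)" for \<eta>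
  define G where "G z = app D (\<phi> (Rp z)) + P (Rp z) + im \<mu> (\<phi> (Rp z))" for z
  define G' where "G' \<eta> = app D (Rm (\<phi> \<eta>)) + Rm (w \<eta>)" for \<eta>
  \<comment> \<open>D stays on u, as \<open>\<phi> \<eta>\<close> need not lie in its domain. The
    identity is checked on the common domain; both sides are continuous in
    \<open>\<eta>\<close>.\<close>
  have weak: "ip (app D (\<phi> u) + P u + im \<mu> (\<phi> u)) \<eta> = ip (app D u) (\<phi> \<eta>) + ip u (w \<eta>)"
    if u: "u \<in> dom_op D" for u \<eta>
  proof -
    have V: "ip (app D (\<phi> u) + P u + im \<mu> (\<phi> u)) x
        = ip (app D u) (\<phi> x) + ip u (app M (\<phi> x) - c x - im \<mu> (\<phi> x))" if "x \<in> ?V" for x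
    proof -
      have x: "x \<in> dom_op D" "x \<in> dom_op M" using that by auto
      have "ip (app D (\<phi> u)) x = ip u (\<phi> (app D x))"
        by (simp add: symmetric_ip[OF Ds \<phi>D[OF u] x(1)] \<phi>)
      moreover have "ip (P u) x = ip u (\<phi> (app M x))"
        using symmetric_ip[OF Ms M\<phi>(1) closure_extends(1)[OF M x(2)], of u]
        by (simp add: P_def closure_extends(2)[OF M x(2)] \<phi>)
      moreover have "ip (im \<mu> (\<phi> u)) x = - ip u (im \<mu> (\<phi> x))"
        by (simp add: ip_im_left ip_sc_right \<phi>)
      moreover have "ip (app D u) (\<phi> x) = ip u (app D (\<phi> x))"
        by (rule symmetric_ip[OF Ds u \<phi>D[OF x(1)]])
      ultimately show ?thesis by (simp add: c_def ip_add_left ip_add_right ip_diff_right)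
    qed
    obtain xs where xs: "\<And>n. xs n \<in> ?V" "hconv H xs \<eta>" using hdense_sequence[OF dense] by blast
    have "hconv H (\<lambda>n. app M (\<phi> (xs n)) - c (xs n) - im \<mu> (\<phi> (xs n))) (w \<eta>)"
      unfolding w_def by (intro hconv_diff hconv_sc P_lim K_lim \<phi>_conv xs)
    then have "(\<lambda>n. ip (app D u) (\<phi> (xs n)) + ip u (app M (\<phi> (xs n)) - c (xs n) - im \<mu> (\<phi> (xs n))))
        \<longlonglongrightarrow> ip (app D u) (\<phi> \<eta>) + ip u (w \<eta>)"
      by (intro tendsto_add tendsto_ip_right \<phi>_conv xs)
    moreover have "(\<lambda>n. ip (app D (\<phi> u) + P u + im \<mu> (\<phi> u)) (xs n))
        \<longlonglongrightarrow> ip (app D (\<phi> u) + P u + im \<mu> (\<phi> u)) \<eta>"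
      by (intro tendsto_ip_right xs)
    ultimately show ?thesis unfolding V[OF xs(1)] using LIMSEQ_unique by blast
  qed
  have G: "ip (G z) \<eta> = ip z (G' \<eta>)" for z \<eta>
  proof -
    have "ip (app D (Rp z)) (\<phi> \<eta>) = ip z (app D (Rm (\<phi> \<eta>)))"
      unfolding DRp DRm
      by (simp add: ip_diff_left ip_add_right ip_im_left ip_sc_right R)
    then show ?thesis
      unfolding G_def G'_def weak[OF Rp(1)] by (simp add: ip_add_right R)
  qed
  have G_sym: "ip (G' x) y = ip x (G y)" for x y by (rule adjoint_pair_sym[OF G])

  \<comment> \<open>Pairing x with \<open>s x + t G G' x\<close> gives s times the square of x plus
    t times the square of \<open>G' x\<close>, hence the lower bound s for all t.\<close>
  have residual: "\<exists>\<eta>. sc (of_real s) \<eta> + G (G' \<eta>) = sc (of_real s) y" if s: "s > 0" for s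
  proof -
    obtain g where g: "g \<ge> 0" "\<And>x. nrm (G x) \<le> g * nrm x" using adjoint_pair_bounded[OF G] by blast
    obtain g' where g': "g' \<ge> 0" "\<And>x. nrm (G' x) \<le> g' * nrm x" using adjoint_pair_bounded[OF G_sym] by blast
    have "\<exists>\<eta>\<in>UNIV. sc (of_real s) \<eta> + G (G' \<eta>) = sc (of_real s) y"
    proof (rule method_of_continuity[where b = "g * g'" and c = s])
      show "x - z \<in> UNIV \<and> sc (of_real s) (x - z) = sc (of_real s) x - sc (of_real s) z \<and>
          G (G' (x - z)) = G (G' x) - G (G' z)" for x z
        by (simp add: sc_diff_right adjoint_pair_diff[OF G] adjoint_pair_diff[OF G_sym])
      show "nrm (G (G' x)) \<le> g * g' * nrm x" for x
        using order_trans[OF g(2) mult_left_mono[OF g'(2) g(1)]] by (simp add: mult.assoc)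
      show "s * nrm x \<le> nrm (sc (of_real s) x + sc (of_real t) (G (G' x)))" if "0 \<le> t" for x t
      proof (cases "x = 0")
        case False
        let ?z = "sc (of_real s) x + sc (of_real t) (G (G' x))"
        have "ip x ?z = s *\<^sub>R (ip x x + (t / s) *\<^sub>R ip (G' x) (G' x))"
          using s by (simp add: ip_add_right ip_of_real_right scaleR_add_right G_sym)
        then have "s * (nrm x)\<^sup>2 \<le> norm (ip x ?z)"
          using norm_ip_le_add[of "t / s" x "G' x"] s that by (simp add: nrm_sq)
        also have "\<dots> \<le> nrm x * nrm ?z" by (rule Cauchy_Schwarz)
        finally show ?thesis using False by (simp add: power2_eq_square mult.left_commute)
      qed simp
      show "\<exists>x\<in>UNIV. sc (of_real s) x = z" for z
        using s by (intro bexI[of _ "sc (of_real (1 / s)) z"]) (simp_all add: sc_sc)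
    qed (use g g' s in auto)
    then show ?thesis by blast
  qed

  \<comment> \<open>L collects the factors of the error in the final estimate, including the bound
    p. With \<open>s = r\<^sup>2\<close> one has \<open>nrm \<delta> \<le> r * nrm y\<close>, and
    the error becomes \<open>r * L\<close>.\<close>
  define L where "L = (nrm y)\<^sup>2 * (1 + p + C + \<bar>\<mu>\<bar> * F + F)"
  have L: "L \<ge> 0" unfolding L_def using bounded(2) comm(2) F(1) by (intro mult_nonneg_nonneg) auto
  define r where "r = min 1 (\<epsilon> / (L + 1))"
  have r: "0 < r" "r \<le> 1" "r * L \<le> \<epsilon>"
  proof -
    show "0 < r" "r \<le> 1" using \<open>\<epsilon> > 0\<close> L by (auto simp: r_def)
    have "r * L \<le> \<epsilon> / (L + 1) * (L + 1)"
      using \<open>\<epsilon> > 0\<close> L by (intro mult_mono) (auto simp: r_def)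
    then show "r * L \<le> \<epsilon>" using L by simp
  qed
  define s where "s = r\<^sup>2"
  have s: "s > 0" using r by (simp add: s_def)
  obtain \<eta> where \<eta>: "sc (of_real s) \<eta> + G (G' \<eta>) = sc (of_real s) y" using residual[OF s] by blast
  define \<delta> where "\<delta> = G' \<eta>"
  define \<zeta> where "\<zeta> = \<phi> \<eta>"
  \<comment> \<open>Dividing the regularised equation by s shows
    \<open>y - \<eta> = G (\<delta> / s)\<close>, which is the image of \<open>\<phi> u\<close>
    under \<open>D + ?M + i mu\<close>.\<close>
  define u where "u = Rp (sc (of_real (1 / s)) \<delta>)"
  have y: "y = \<eta> + G (sc (of_real (1 / s)) \<delta>)"
  proof -
    have "y = sc (of_real (1 / s)) (sc (of_real s) \<eta> + G \<delta>)"
      unfolding \<delta>_def \<eta> using s by (simp add: sc_sc)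
    then show ?thesis using s by (simp add: sc_add_right sc_sc adjoint_pair_sc[OF G_sym])
  qed
  \<comment> \<open>Dropping the \<open>\<delta>\<close> term bounds \<open>\<eta>\<close> by y;
    dropping the \<open>\<eta>\<close> term makes \<open>\<delta>\<close> of order
    \<open>sqrt s = r\<close>.\<close>
  have ip_\<eta>: "ip \<eta> y = ip \<eta> \<eta> + (1 / s) *\<^sub>R ip \<delta> \<delta>"
    by (subst (1) y) (simp only: ip_add_right flip: G_sym, simp only: ip_of_real_right \<delta>_def)
  then have \<eta>_sq: "(nrm \<eta>)\<^sup>2 \<le> norm (ip \<eta> y)"
    using norm_ip_le_add[of "1 / s" \<eta> \<delta>] s by (simp add: nrm_sq)
  then have "nrm \<eta> * nrm \<eta> \<le> nrm \<eta> * nrm y"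
    using Cauchy_Schwarz[of \<eta> y] by (simp add: power2_eq_square)
  then have \<eta>_le: "nrm \<eta> \<le> nrm y" by (cases "\<eta> = 0") simp_all
  have \<delta>_le: "nrm \<delta> \<le> r * nrm y"
  proof -
    have "ip \<delta> \<delta> + s *\<^sub>R ip \<eta> \<eta> = s *\<^sub>R ip \<eta> y"
      using s by (simp add: ip_\<eta> scaleR_add_right)
    then have "(nrm \<delta>)\<^sup>2 \<le> s * norm (ip \<eta> y)"
      using norm_ip_le_add[of s \<delta> \<eta>] s by (simp add: nrm_sq)
    also have "\<dots> \<le> s * (nrm y * nrm y)"
      using Cauchy_Schwarz[of \<eta> y] mult_right_mono[OF \<eta>_le nrm_ge_0[of y]] s
      by (intro mult_left_mono) auto
    also have "\<dots> = (r * nrm y)\<^sup>2" by (simp add: s_def power2_eq_square)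
    finally show ?thesis by (rule power2_le_imp_le) (use r in simp)
  qed
  have \<zeta>_le: "nrm \<zeta> \<le> F * nrm y"
    using order_trans[OF F(2) mult_left_mono[OF \<eta>_le F(1)]] by (simp add: \<zeta>_def)

  \<comment> \<open>\<open>\<zeta>\<close> may lie outside \<open>dom_op D\<close>, but by the
    formula for \<open>G'\<close> the difference \<open>\<zeta> - \<delta>\<close> is a combination
    of resolvent values. So v replaces \<open>\<zeta>\<close> at the cost of the small
    \<open>\<delta>\<close>.\<close>
  define v where "v = \<zeta> - \<delta>"
  have v_eq: "v = - (im 1 (Rm \<zeta>) + Rm (w \<eta>))"
    unfolding v_def \<delta>_def G'_def \<zeta>_def[symmetric] DRm by simp
  then have v_eq': "v = im (- 1) (Rm \<zeta>) - Rm (w \<eta>)" by (simp add: im_minus)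
  have v: "v \<in> dom_op D" "app D v = im (- 1) (app D (Rm \<zeta>)) - app D (Rm (w \<eta>))"
    unfolding v_eq' using Rm(1) by (simp_all add: opD)
  have Dv: "app D v = - im 1 \<delta> - w \<eta>"
  proof -
    have "app D v = - (im 1 (\<zeta> + im 1 (Rm \<zeta>)) + (w \<eta> + im 1 (Rm (w \<eta>))))"
      unfolding v(2) by (simp add: im_minus DRm)
    also have "\<dots> = im 1 v - im 1 \<zeta> - w \<eta>"
      unfolding v_eq by (simp add: sc_add_right sc_diff_right sc_minus_right)
    finally show ?thesis by (simp add: v_def sc_diff_right)
  qed
  \<comment> \<open>Q is skew-adjoint and Z is self-adjoint, by symmetry of D and \<open>?M\<close>.
    Hence \<open>Q = Z + Y\<close> yields \<open>2 Q = Y - cstar Y\<close>: the uncontrolled Z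
    disappears, and Y involves only \<open>\<delta>\<close> and the commutator K.\<close>
  define Q where "Q = scaleC (Complex 0 \<mu>) (ip \<zeta> \<zeta>)"
  define Z where "Z = ip v (app D v) + ip \<zeta> (P \<eta>)"
  define Y where "Y = ip \<delta> (app D v) + ip \<zeta> (im 1 \<delta>) - ip \<zeta> (K \<eta>)"
  have "ip \<zeta> (app D v) = ip v (app D v) + ip \<delta> (app D v)"
    by (simp add: v_def ip_diff_left)
  moreover have "ip \<zeta> (app D v) = - ip \<zeta> (im 1 \<delta>) - ip \<zeta> (P \<eta>) + ip \<zeta> (K \<eta>) + Q"
    unfolding Dv w_def Q_def \<zeta>_def[symmetric]
    by (simp add: ip_diff_right ip_minus_right ip_sc_right[of _ "Complex 0 \<mu>"])
  ultimately have Q: "Q = Z + Y" by (simp add: Z_def Y_def algebra_simps)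
  have "cstar Z = Z"
    using symmetric_ip[OF Ds v(1) v(1)] symmetric_ip[OF Ms M\<phi>(1) M\<phi>(1), of \<eta> \<eta>]
    by (simp add: Z_def cstar_add P_def \<zeta>_def flip: ip_commute)
  moreover have "cstar Q = - Q"
  proof -
    have "cnj (Complex 0 \<mu>) = - Complex 0 \<mu>" by (simp add: complex_eq_iff)
    then show ?thesis by (simp add: Q_def cstar_scaleC scaleC_minus_left flip: ip_commute)
  qed
  ultimately have "2 *\<^sub>R Q = Y - cstar Y"
    using arg_cong[OF Q, of cstar] Q by (simp add: cstar_add scaleR_2 algebra_simps)
  then have "norm (2 *\<^sub>R Q) \<le> norm Y + norm Y" by (metis norm_cstar norm_triangle_ineq4)
  then have "norm Q \<le> norm Y" by simp
  then have "\<bar>\<mu>\<bar> * (nrm \<zeta>)\<^sup>2 \<le> norm Y" by (simp add: Q_def norm_scaleC nrm_sq)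
  also have "norm Y \<le> nrm \<delta> * nrm (app D v) + nrm \<zeta> * nrm \<delta> + nrm \<zeta> * nrm (K \<eta>)"
  proof -
    have "norm Y \<le> norm (ip \<delta> (app D v)) + norm (ip \<zeta> (im 1 \<delta>)) + norm (ip \<zeta> (K \<eta>))"
      unfolding Y_def by (intro norm_triangle_le_diff norm_triangle_mono add_right_mono norm_triangle_ineq)
    then show ?thesis
      using Cauchy_Schwarz[of \<delta> "app D v"] Cauchy_Schwarz[of \<zeta> "im 1 \<delta>"] Cauchy_Schwarz[of \<zeta> "K \<eta>"]
      by (simp add: nrm_sc)
  qed
  also have "\<dots> \<le> nrm \<delta> * (nrm (app D v) + nrm \<zeta>) + C * nrm \<zeta> * nrm \<eta>"
    using mult_left_mono[OF K[of \<eta>] nrm_ge_0[of \<zeta>]] by (simp add: algebra_simps)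
  also have "nrm \<delta> * (nrm (app D v) + nrm \<zeta>) \<le> (r * nrm y) * ((1 + p + C + \<bar>\<mu>\<bar> * F + F) * nrm y)"
  proof (intro mult_mono)
    have "nrm (app D v) \<le> nrm \<delta> + nrm (w \<eta>)"
      unfolding Dv using nrm_triangle_diff[of "- im 1 \<delta>" "w \<eta>"] by (simp add: nrm_sc)
    also have "nrm \<delta> \<le> nrm y"
      using \<delta>_le mult_right_mono[OF r(2) nrm_ge_0[of y]] by simp
    also have "nrm (w \<eta>) \<le> (p + C + \<bar>\<mu>\<bar> * F) * nrm y"
    proof -
      have "nrm (w \<eta>) \<le> nrm (P \<eta>) + nrm (K \<eta>) + \<bar>\<mu>\<bar> * nrm (\<phi> \<eta>)"
        unfolding w_def using nrm_triangle_diff[of "P \<eta> - K \<eta>" "im \<mu> (\<phi> \<eta>)"] nrm_triangle_diff[of "P \<eta>" "K \<eta>"]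
        by (simp add: nrm_sc)
      also have "\<dots> \<le> p * nrm y + C * nrm y + \<bar>\<mu>\<bar> * (F * nrm y)"
        using order_trans[OF P mult_left_mono[OF \<eta>_le bounded(2)]]
          order_trans[OF K mult_left_mono[OF \<eta>_le comm(2)]] \<zeta>_le
        unfolding \<zeta>_def by (intro add_mono mult_left_mono) auto
      finally show ?thesis by (simp add: algebra_simps)
    qed
    finally show "nrm (app D v) + nrm \<zeta> \<le> (1 + p + C + \<bar>\<mu>\<bar> * F + F) * nrm y"
      using \<zeta>_le by (simp add: algebra_simps)
  qed (use \<delta>_le r in auto)
  also have "\<dots> = r * L" by (simp add: L_def power2_eq_square)
  finally have "\<bar>\<mu>\<bar> * (nrm (\<phi> \<eta>))\<^sup>2 \<le> C * nrm (\<phi> \<eta>) * nrm \<eta> + \<epsilon>"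
    using r(3) by (simp add: \<zeta>_def)
  moreover have "y - (app D (\<phi> u) + app ?M (\<phi> u) + im \<mu> (\<phi> u)) = \<eta>"
    unfolding P_def[symmetric] u_def G_def[symmetric] by (subst y) simp
  moreover have "u \<in> dom_op D" unfolding u_def by (rule Rp(1))
  ultimately show thesis using that M\<phi>(1) \<eta>_sq by blast
qed

text \<open>Read h, z, N as the norms of \<open>\<eta>\<close>, \<open>\<phi> k \<eta>\<close>, y.
  If z > N/4, then h < 4 z, so the part 4 C of \<open>\<mu>\<close> absorbs the commutator term and
  the remaining 4 contradicts the error \<open>N\<^sup>2 / 4\<close>. Otherwise
  \<open>h\<^sup>2\<close> is at most \<open>N\<^sup>2 / 2\<close>, which is below
  \<open>(3 N / 4)\<^sup>2\<close> up to equality at N = 0.\<close>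

lemma contraction_estimate:
  fixes N h z :: real
  assumes "0 \<le> h" "0 \<le> z" "0 \<le> C" "0 \<le> N"
    and \<mu>: "4 * C + 4 \<le> \<mu>" and z: "\<mu> * z\<^sup>2 \<le> C * z * h + N\<^sup>2 / 4"
    and h: "h\<^sup>2 \<le> h * N" "h\<^sup>2 \<le> z * N + h * (N / 4)"
  shows "h \<le> 3 / 4 * N"
proof (cases "h = 0")
  case False
  with assms(1) h(1) have "h \<le> N" by (simp add: power2_eq_square)
  have "z \<le> N / 4"
  proof (rule ccontr)
    assume "\<not> z \<le> N / 4"
    then have less: "N / 4 < z" by simp
    have "(4 * C + 4) * z\<^sup>2 \<le> \<mu> * z\<^sup>2" using \<mu> by (rule mult_right_mono) simp
    moreover have "C * z * h \<le> C * z * (4 * z)"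
      using \<open>h \<le> N\<close> less assms(2,3) by (intro mult_left_mono) auto
    ultimately have "4 * z\<^sup>2 \<le> N\<^sup>2 / 4" using z by (simp add: power2_eq_square algebra_simps)
    moreover have "(N / 4)\<^sup>2 < z\<^sup>2" using less assms(4) by (intro power_strict_mono) auto
    ultimately show False by (simp add: power2_eq_square)
  qed
  then have "z * N + h * (N / 4) \<le> N / 4 * N + N * (N / 4)"
    using \<open>h \<le> N\<close> assms(4) by (intro add_mono mult_right_mono) auto
  also have "\<dots> \<le> (3 / 4 * N)\<^sup>2" by (simp add: power2_eq_square)
  finally have "h\<^sup>2 \<le> (3 / 4 * N)\<^sup>2" using h(2) by simp
  then show ?thesis by (rule power2_le_imp_le) (use assms(4) in simp)
qed (use assms(4) in simp)

text \<open>N is any symmetric restriction of the closure of M whose domain contains the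
  approximants \<open>\<phi> k u\<close>; the closure itself and M are the two choices made
  later.\<close>

proposition range_dense:
  assumes D: "selfadjoint_op H D" "regular_op H D" and M: "symmetric_op H M"
    and dense: "hdense H (dom_op D \<inter> dom_op M)"
    and \<phi>: "\<And>k x y. ip (\<phi> k x) y = ip x (\<phi> k y)" and \<phi>_lim: "\<And>x. hconv H (\<lambda>k. \<phi> k x) x"
    and \<phi>D: "\<And>k x. x \<in> dom_op D \<Longrightarrow> \<phi> k x \<in> dom_op D"
    and \<phi>M: "\<And>k x. x \<in> dom_op M \<Longrightarrow> \<phi> k x \<in> dom_op M"
    and comm: "\<And>k x. x \<in> dom_op D \<Longrightarrow> x \<in> dom_op M \<Longrightarrow>
      nrm (app D (\<phi> k x) + app M (\<phi> k x) - \<phi> k (app D x) - \<phi> k (app M x)) \<le> C * nrm x" "0 \<le> C"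
    and bounded: "\<And>k. bounded_on H (dom_op M) (\<lambda>x. app M (\<phi> k x))"
    and \<mu>: "4 * C + 4 \<le> \<bar>\<mu>\<bar>"
    and N: "symmetric_op H N" "\<And>k u. u \<in> dom_op D \<Longrightarrow> \<phi> k u \<in> dom_op N"
      "\<And>x. x \<in> dom_op N \<Longrightarrow> app N x = app (op_closure H M) x"
    and DN: "hdense H (dom_op D \<inter> dom_op N)"
  shows "hdense H ((\<lambda>x. app (op_sum D N) x + im \<mu> x) ` dom_op (op_sum D N))"
proof (rule hdense_by_contraction[where q = "3 / 4"])
  let ?T = "op_sum D N"
  have T: "symmetric_op H ?T" by (rule op_sum_symmetric[OF selfadjoint_symmetric[OF D(1)] N(1) DN])
  note opT = is_operatorD[OF symmetric_is_operator[OF T]]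
  show zero: "0 \<in> (\<lambda>x. app ?T x + im \<mu> x) ` dom_op ?T"
    by (rule image_eqI[of _ _ 0]) (simp_all add: opT(1,2))
  show "x + y \<in> (\<lambda>x. app ?T x + im \<mu> x) ` dom_op ?T"
    if "x \<in> (\<lambda>x. app ?T x + im \<mu> x) ` dom_op ?T" "y \<in> (\<lambda>x. app ?T x + im \<mu> x) ` dom_op ?T" for x y
  proof -
    from that obtain u v where u: "u \<in> dom_op ?T" "x = app ?T u + im \<mu> u"
      and v: "v \<in> dom_op ?T" "y = app ?T v + im \<mu> v" by blast
    show ?thesis
      by (rule image_eqI[of _ _ "u + v"]) (use u v in \<open>simp_all add: opT(3,4) sc_add_right\<close>)
  qed
  show "\<exists>r\<in>(\<lambda>x. app ?T x + im \<mu> x) ` dom_op ?T. nrm (y - r) \<le> 3 / 4 * nrm y" for y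
  proof (cases "y = 0")
    case True
    then show ?thesis using zero by (intro bexI[of _ 0]) auto
  next
    case False
    then have "nrm y > 0" by simp
    then obtain k where k: "nrm (\<phi> k y - y) < nrm y / 4"
      using order_tendstoD(2)[OF \<phi>_lim[of y, unfolded hconv_def], of "nrm y / 4"]
      by (auto simp: eventually_sequentially)
    obtain p0 where p0: "\<And>x. x \<in> dom_op M \<Longrightarrow> nrm (app M (\<phi> k x)) \<le> p0 * nrm x"
      using bounded[of k] unfolding bounded_on_def by blast
    have p: "nrm (app M (\<phi> k x)) \<le> \<bar>p0\<bar> * nrm x" if "x \<in> dom_op M" for x
      using order_trans[OF p0[OF that] mult_right_mono[OF abs_ge_self]] by simp
    have "(nrm y)\<^sup>2 / 4 > 0" using \<open>nrm y > 0\<close> by simp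
    then obtain u \<eta> where u: "u \<in> dom_op D"
      "y - (app D (\<phi> k u) + app (op_closure H M) (\<phi> k u) + im \<mu> (\<phi> k u)) = \<eta>"
      and \<eta>: "(nrm \<eta>)\<^sup>2 \<le> norm (ip \<eta> y)"
      "\<bar>\<mu>\<bar> * (nrm (\<phi> k \<eta>))\<^sup>2 \<le> C * nrm (\<phi> k \<eta>) * nrm \<eta> + (nrm y)\<^sup>2 / 4"
      using regularised_residual[OF D M dense \<phi> \<phi>D \<phi>M comm p abs_ge_zero] by blast
    \<comment> \<open>Self-adjointness moves \<open>\<phi> k\<close> from the unknown
      \<open>\<eta>\<close>, which depends on k, to y, for which k was chosen.\<close>
    have "ip \<eta> y = ip (\<phi> k \<eta>) y - ip \<eta> (\<phi> k y - y)" by (simp add: ip_diff_right \<phi>)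
    then have "norm (ip \<eta> y) \<le> norm (ip (\<phi> k \<eta>) y) + norm (ip \<eta> (\<phi> k y - y))"
      by (metis norm_triangle_ineq4)
    also have "\<dots> \<le> nrm (\<phi> k \<eta>) * nrm y + nrm \<eta> * (nrm y / 4)"
      using k by (intro add_mono order_trans[OF Cauchy_Schwarz] mult_left_mono) auto
    finally have "(nrm \<eta>)\<^sup>2 \<le> nrm (\<phi> k \<eta>) * nrm y + nrm \<eta> * (nrm y / 4)" using \<eta>(1) by simp
    then have "nrm \<eta> \<le> 3 / 4 * nrm y"
      using contraction_estimate[OF _ _ comm(2) _ \<mu> \<eta>(2)] order_trans[OF \<eta>(1) Cauchy_Schwarz] by simp
    moreover have "\<phi> k u \<in> dom_op ?T" "app ?T (\<phi> k u) = app D (\<phi> k u) + app (op_closure H M) (\<phi> k u)"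
      using N(2)[OF u(1), of k] \<phi>D[OF u(1), of k] by (simp_all add: op_sum_def N(3))
    ultimately have "nrm (y - (app ?T (\<phi> k u) + im \<mu> (\<phi> k u))) \<le> 3 / 4 * nrm y" "\<phi> k u \<in> dom_op ?T"
      using u(2) by simp_all
    then show ?thesis by blast
  qed
qed auto

end

theorem mainTheorem8:
  fixes H :: "('e::ab_group_add, 'b::cstar_algebra) hmod"
    and D M :: "'e op"
    and \<phi> :: "nat \<Rightarrow> 'e \<Rightarrow> 'e"
  assumes "hilbert_module H"
    and "regular_op H D" and "selfadjoint_op H D"
    and "symmetric_op H M"
    and "hdense H (dom_op D \<inter> dom_op M)"
    and "adequate_approx_id H D \<phi>"
    and "locally_bounded H M \<phi>"
    and "uniformly_bounded_comm H (dom_op M) M \<phi>"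
  shows "regular_op H (op_closure H (op_sum D (op_closure H M))) \<and>
         selfadjoint_op H (op_closure H (op_sum D (op_closure H M))) \<and>
         ((\<forall>k. \<phi> k ` dom_op D \<subseteq> dom_op M) \<longrightarrow>
         regular_op H (op_closure H (op_sum D M)) \<and>
         selfadjoint_op H (op_closure H (op_sum D M)) \<and>
         op_eq (op_closure H (op_sum D M)) (op_closure H (op_sum D (op_closure H M))))"
proof -
  interpret hilbert_mod H by (rule hilbert_mod.intro[OF assms(1)])
  let ?M = "op_closure H M"
  note D = assms(3,2) and M = assms(4) and dense = assms(5)
  have Ds: "symmetric_op H D" by (rule selfadjoint_symmetric[OF D(1)])
  \<comment> \<open>As D is closed and self-adjoint, closure and adjoint in
    \<open>adequate_approx_id\<close> reduce to D: \<open>\<phi> k\<close> preserves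
    \<open>dom_op D\<close>, and the commutator bound concerns D itself.\<close>
  have D_closure: "dom_op (op_closure H D) = dom_op D"
    "\<And>x. x \<in> dom_op D \<Longrightarrow> app (op_closure H D) x = app D x"
    using closure_of_closed[OF Ds] D(2) unfolding regular_op_def op_eq_def by auto
  have D_adjoint: "dom_op (adjoint H D) = dom_op D"
    using D(1) unfolding selfadjoint_op_def op_eq_def by auto
  have approx: "seq_approx_id H \<phi>" and \<phi>D0: "\<And>k. \<phi> k ` dom_op (adjoint H D) \<subseteq> dom_op (op_closure H D)"
    and commD: "uniformly_bounded_comm H (dom_op D) (op_closure H D) \<phi>"
    using assms(6) unfolding adequate_approx_id_def by auto
  have \<phi>: "ip (\<phi> k x) y = ip x (\<phi> k y)" and \<phi>_lim: "hconv H (\<lambda>k. \<phi> k x) x" for k x y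
    using approx unfolding seq_approx_id_def selfadjoint_end_def by blast+
  have \<phi>D: "\<phi> k x \<in> dom_op D" if "x \<in> dom_op D" for k x
    using \<phi>D0[of k] that unfolding D_closure D_adjoint by blast
  have \<phi>M: "\<phi> k x \<in> dom_op M" if "x \<in> dom_op M" for k x
    using assms(7) that unfolding locally_bounded_def by blast
  have bounded: "bounded_on H (dom_op M) (\<lambda>x. app M (\<phi> k x))" for k
    using assms(7) unfolding locally_bounded_def by blast
  obtain C1 where C1: "nrm (app D (\<phi> k x) - \<phi> k (app D x)) \<le> C1 * nrm x" if "x \<in> dom_op D" for k x
    using commD unfolding uniformly_bounded_comm_def commutator_def by (metis D_closure(2) \<phi>D)
  obtain C2 where C2: "nrm (app M (\<phi> k x) - \<phi> k (app M x)) \<le> C2 * nrm x" if "x \<in> dom_op M" for k x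
    using assms(8) unfolding uniformly_bounded_comm_def commutator_def by blast
  define C where "C = \<bar>C1\<bar> + \<bar>C2\<bar>"
  have C: "0 \<le> C" by (simp add: C_def)
  have comm: "nrm (app D (\<phi> k x) + app M (\<phi> k x) - \<phi> k (app D x) - \<phi> k (app M x)) \<le> C * nrm x"
    if x: "x \<in> dom_op D" "x \<in> dom_op M" for k x
  proof -
    have "app D (\<phi> k x) + app M (\<phi> k x) - \<phi> k (app D x) - \<phi> k (app M x)
        = (app D (\<phi> k x) - \<phi> k (app D x)) + (app M (\<phi> k x) - \<phi> k (app M x))" by simp
    also have "nrm \<dots> \<le> C1 * nrm x + C2 * nrm x"
      by (rule order_trans[OF nrm_triangle add_mono[OF C1[OF x(1)] C2[OF x(2)]]])
    also have "\<dots> \<le> \<bar>C1\<bar> * nrm x + \<bar>C2\<bar> * nrm x"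
      by (intro add_mono mult_right_mono) auto
    finally show ?thesis by (simp add: C_def distrib_right)
  qed
  \<comment> \<open>The threshold of \<open>contraction_estimate\<close>. The range criterion asks
    for density with both \<open>\<mu>\<close> and \<open>- \<mu>\<close>.\<close>
  define \<mu> where "\<mu> = 4 * C + 4"
  have \<mu>: "\<mu> > 0" "4 * C + 4 \<le> \<bar>\<mu>\<bar>" "4 * C + 4 \<le> \<bar>- \<mu>\<bar>" using C by (simp_all add: \<mu>_def)
  have closure_sa: "selfadjoint_op H (op_closure H (op_sum D N)) \<and> regular_op H (op_closure H (op_sum D N))
      \<and> symmetric_op H (op_sum D N)
      \<and> (\<forall>y. \<exists>x\<in>dom_op (op_closure H (op_sum D N)). app (op_closure H (op_sum D N)) x + im \<mu> x = y)"
    if N: "symmetric_op H N" "\<And>k u. u \<in> dom_op D \<Longrightarrow> \<phi> k u \<in> dom_op N"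
      "\<And>x. x \<in> dom_op N \<Longrightarrow> app N x = app ?M x" and DN: "hdense H (dom_op D \<inter> dom_op N)" for N
  proof -
    have T: "symmetric_op H (op_sum D N)" by (rule op_sum_symmetric[OF Ds N(1) DN])
    have r: "hdense H ((\<lambda>x. app (op_sum D N) x + im \<nu> x) ` dom_op (op_sum D N))"
      if "4 * C + 4 \<le> \<bar>\<nu>\<bar>" for \<nu>
      by (rule range_dense[where C = C and M = M and \<phi> = \<phi>])
        (fact D M dense \<phi> \<phi>_lim \<phi>D \<phi>M comm C bounded that N DN)+
    show ?thesis
      using closure_selfadjoint_regular[OF T \<mu>(1) r[OF \<mu>(2)] r[OF \<mu>(3)]] T by blast
  qed
  \<comment> \<open>This is the domain condition on N for the choice of N as the closure of
    M.\<close>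
  have \<phi>M': "\<phi> k u \<in> dom_op ?M" for k u
  proof -
    obtain p where p: "\<And>x. x \<in> dom_op M \<Longrightarrow> nrm (app M (\<phi> k x)) \<le> p * nrm x"
      using bounded[of k] unfolding bounded_on_def by blast
    have "nrm (app M (\<phi> k x)) \<le> \<bar>p\<bar> * nrm x" if "x \<in> dom_op M" for x
      using order_trans[OF p[OF that] mult_right_mono[OF abs_ge_self]] by simp
    from locally_bounded_closure(1)[OF M \<phi> \<phi>M this abs_ge_zero] show ?thesis by blast
  qed
  have dense': "hdense H (dom_op D \<inter> dom_op ?M)"
    using closure_extends(1)[OF M] by (intro hdense_mono[OF dense]) auto
  have cl: "selfadjoint_op H (op_closure H (op_sum D ?M))" "regular_op H (op_closure H (op_sum D ?M))"
    "symmetric_op H (op_sum D ?M)"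
    using closure_sa[OF closure_symmetric[OF M] \<phi>M' refl dense'] by auto
  moreover have "regular_op H (op_closure H (op_sum D M)) \<and> selfadjoint_op H (op_closure H (op_sum D M)) \<and>
      op_eq (op_closure H (op_sum D M)) (op_closure H (op_sum D ?M))"
    if incl: "\<forall>k. \<phi> k ` dom_op D \<subseteq> dom_op M"
  proof -
    have "\<phi> k u \<in> dom_op M" if "u \<in> dom_op D" for k u using incl that by blast
    from closure_sa[OF M this closure_extends(2)[OF M, symmetric] dense]
    have sa: "selfadjoint_op H (op_closure H (op_sum D M))" "regular_op H (op_closure H (op_sum D M))"
      and sym: "symmetric_op H (op_sum D M)"
      and surj: "\<And>y. \<exists>x\<in>dom_op (op_closure H (op_sum D M)). app (op_closure H (op_sum D M)) x + im \<mu> x = y"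
      by auto
    \<comment> \<open>The closure of \<open>D + M\<close> is contained in that of
      \<open>D + ?M\<close>; being onto after adding \<open>i mu\<close>, it has no proper symmetric
      extension.\<close>
    have "op_eq (op_closure H (op_sum D M)) (op_closure H (op_sum D ?M))"
    proof (rule selfadjoint_maximal[OF surj \<mu>(1) closure_symmetric[OF cl(3)]])
      fix x assume "x \<in> dom_op (op_closure H (op_sum D M))"
      then obtain xs where xs: "\<And>n. xs n \<in> dom_op (op_sum D M)" "hconv H xs x"
        "hconv H (\<lambda>n. app (op_sum D M) (xs n)) (app (op_closure H (op_sum D M)) x)"
        using closureE[OF sym] by metis
      have sub: "xs n \<in> dom_op (op_sum D ?M)" "app (op_sum D ?M) (xs n) = app (op_sum D M) (xs n)" for n
        using xs(1)[of n] closure_extends[OF M] by (auto simp: op_sum_def)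
      from closureI[OF cl(3) sub(1) xs(2)] xs(3)
      show "x \<in> dom_op (op_closure H (op_sum D ?M)) \<and>
          app (op_closure H (op_sum D ?M)) x = app (op_closure H (op_sum D M)) x"
        unfolding sub(2) by blast
    qed
    with sa show ?thesis by blast
  qed
  ultimately show ?thesis by blast
qed

end
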